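(* Let $d\in\mathbb{Z}_{>0}$ and let $X=\begin{pmatrix}z\sqrt{\epsilon}&u\sqrt{\epsilon}\\ v\sqrt{\epsilon}&z\sqrt{\epsilon}\end{pmatrix}$ with $z,u,v\in F$, $\nu(z)\geq -d$ and $\nu(v)>\nu(u)=-d$. Let $\zeta$ be a character of $T(X)$ which coincides with $\Psi_X$ on the intersection $T(X)\cap\mathcal{J}_d$, and write $\Psi_{X,\zeta}$ for the unique character of $T(X)\mathcal{J}_d$ which extends $\zeta$ and $\Psi_X$. Then \[ \mathcal{S}_d(X,\zeta):=\mathrm{Ind}_{T(X)\mathcal{J}_d}^{\mathcal{K}}\Psi_{X,\zeta} \] is an irreducible representation of $\mathcal{K}$ of depth $d$ and of degree $q^{d-1}(q^2-1)$.
   Context: $F$ is a non-archimedean local field with residual characteristic $p\neq 2$, residue field of cardinality $q$, uniformiser $\varpi$ and valuation $\nu$ with $\nu(\varpi)=1$; $E=F[\sqrt{\epsilon}]$ is the unramified quadratic extension ($\epsilon\in\mathcal{O}_F^\times$ a non-square), $x\mapsto\overline{x}$ the nontrivial Galois automorphism, $\mathfrak{p}_E,\mathfrak{p}_F$ the maximal ideals. $G=\{g\in M_2(E)\mid \overline{g}^{\top}\mathrm{w}g=\mathrm{w}\}$ with $\mathrm{w}=\begin{pmatrix}0&1\\1&0\end{pmatrix}$, $\mathcal{K}=G\cap M_2(\mathcal{O}_E)$, $\mathcal{K}_n=\begin{pmatrix}1+\mathfrak{p}_E^n&\mathfrak{p}_E^n\\ \mathfrak{p}_E^n&1+\mathfrak{p}_E^n\end{pmatrix}\cap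 G$ for integers $n\ge0$ (and $\mathcal{K}_s=\mathcal{K}_{\lceil s\rceil}$, $\mathcal{K}_{s+}$ the next smaller filtration group), with Lie algebra filtration $\mathfrak{k}_r=\begin{pmatrix}\mathfrak{p}_E^{\lceil r\rceil}&\sqrt{\epsilon}\mathfrak{p}_F^{\lceil r\rceil}\\ \sqrt{\epsilon}\mathfrak{p}_F^{\lceil r\rceil}&\mathfrak{p}_E^{\lceil r\rceil}\end{pmatrix}\cap\mathfrak{k}$. $\psi$ is an additive character of $E$ trivial on $\mathfrak{p}_E$ and nontrivial on $\mathcal{O}_E$ (of the form $\psi(x)=\psi'((x+\overline{x})/2)$ for $\psi'$ a character of $F$ trivial on $\mathfrak{p}_F$, nontrivial on $\mathcal{O}_F$). For $X\in\mathfrak{k}_{-d}$, $\Psi_X(k)=\psi(\mathrm{Tr}(X(k-I)))$ is a character of $\mathcal{J}_d$ (in particular of $\mathcal{K}_{\frac d2+}$), where $\mathcal{J}_d=\begin{pmatrix}1+\mathfrak{p}_E^{\lceil d/2\rceil}&\mathfrak{p}_E^{\lceil d/2\rceil}\\ \mathfrak{p}_E^{\lceil (d+1)/2\rceil}&1+\mathfrak{p}_E^{\lceil d/2\rceil}\end{pmatrix}\cap G$ (equal to $\mathcal{K}_{d/2}$ when $d$ is odd). $T(X)$ denotes the centralizer of $X$ in $\mathcal{K}$ (an abelian group). Depth of a representation of $\mathcal{K}$ is the least $r$ such that it factors through $\mathcal{K}/\mathcal{K}_{r+}$. *)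

theory Defs
  imports Complex_Main "HOL-Library.Function_Algebras" "HOL-Computational_Algebra.Primes"
begin

text \<open>Elements of F have type 'a (a field); the valuation is nu :: 'a => int,
only meaningful on nonzero elements (nu 0 = infinity is encoded by the guard x = 0).\<close>

definition vge :: "('a::field \<Rightarrow> int) \<Rightarrow> int \<Rightarrow> 'a \<Rightarrow> bool" where
  "vge nu n x \<longleftrightarrow> x = 0 \<or> nu x \<ge> n"

definition residue_rel :: "('a::field \<Rightarrow> int) \<Rightarrow> ('a \<times> 'a) set" where
  "residue_rel nu = {(x, y). vge nu 0 x \<and> vge nu 0 y \<and> vge nu 1 (x - y)}"

definition nonarch_local_field :: "('a::field \<Rightarrow> int) \<Rightarrow> nat \<Rightarrow> nat \<Rightarrow> bool" where
  "nonarch_local_field nu p q \<longleftrightarrow>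
     (\<forall>x y. x \<noteq> 0 \<longrightarrow> y \<noteq> 0 \<longrightarrow> nu (x * y) = nu x + nu y) \<and>
     (\<forall>x y. x \<noteq> 0 \<longrightarrow> y \<noteq> 0 \<longrightarrow> x + y \<noteq> 0 \<longrightarrow> nu (x + y) \<ge> min (nu x) (nu y)) \<and>
     (\<exists>w. w \<noteq> 0 \<and> nu w = 1) \<and>
     (\<forall>s :: nat \<Rightarrow> 'a.
        (\<forall>N. \<exists>M. \<forall>m\<ge>M. \<forall>n\<ge>M. vge nu N (s m - s n)) \<longrightarrow>
        (\<exists>L. \<forall>N. \<exists>M. \<forall>n\<ge>M. vge nu N (s n - L))) \<and>
     finite ({x. vge nu 0 x} // residue_rel nu) \<and>
     card ({x. vge nu 0 x} // residue_rel nu) = q \<and>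
     prime p \<and> vge nu 1 (of_nat p)"

datatype 'a qe = QE (re: 'a) (im: 'a)   \<comment> \<open>QE a b represents a + b sqrt(eps)\<close>

definition qadd :: "'a::field qe \<Rightarrow> 'a qe \<Rightarrow> 'a qe" where
  "qadd x y = QE (re x + re y) (im x + im y)"
definition qsub :: "'a::field qe \<Rightarrow> 'a qe \<Rightarrow> 'a qe" where
  "qsub x y = QE (re x - re y) (im x - im y)"
definition qmul :: "'a::field \<Rightarrow> 'a qe \<Rightarrow> 'a qe \<Rightarrow> 'a qe" where
  "qmul eps x y = QE (re x * re y + eps * im x * im y) (re x * im y + im x * re y)"
definition qconj :: "'a::field qe \<Rightarrow> 'a qe" where
  "qconj x = QE (re x) (- im x)"
definition qzero :: "'a::field qe" where "qzero = QE 0 0"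
definition qone :: "'a::field qe" where "qone = QE 1 0"

text \<open>p_E^n = varpi^n O_E = p_F^n + sqrt(eps) p_F^n (E/F unramified, O_E = O_F[sqrt eps]).\<close>
definition in_pE :: "('a::field \<Rightarrow> int) \<Rightarrow> int \<Rightarrow> 'a qe \<Rightarrow> bool" where
  "in_pE nu n x \<longleftrightarrow> vge nu n (re x) \<and> vge nu n (im x)"

datatype 'a m2 = M2 (m11: "'a qe") (m12: "'a qe") (m21: "'a qe") (m22: "'a qe")

definition mmul :: "'a::field \<Rightarrow> 'a m2 \<Rightarrow> 'a m2 \<Rightarrow> 'a m2" where
  "mmul eps A B = M2
     (qadd (qmul eps (m11 A) (m11 B)) (qmul eps (m12 A) (m21 B)))
     (qadd (qmul eps (m11 A) (m12 B)) (qmul eps (m12 A) (m22 B)))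
     (qadd (qmul eps (m21 A) (m11 B)) (qmul eps (m22 A) (m21 B)))
     (qadd (qmul eps (m21 A) (m12 B)) (qmul eps (m22 A) (m22 B)))"
definition msub :: "'a::field m2 \<Rightarrow> 'a m2 \<Rightarrow> 'a m2" where
  "msub A B = M2 (qsub (m11 A) (m11 B)) (qsub (m12 A) (m12 B))
                 (qsub (m21 A) (m21 B)) (qsub (m22 A) (m22 B))"
definition mconjT :: "'a::field m2 \<Rightarrow> 'a m2" where
  "mconjT A = M2 (qconj (m11 A)) (qconj (m21 A)) (qconj (m12 A)) (qconj (m22 A))"
definition mid :: "'a::field m2" where "mid = M2 qone qzero qzero qone"
definition mw :: "'a::field m2" where "mw = M2 qzero qone qone qzero"
definition mtrace :: "'a::field m2 \<Rightarrow> 'a qe" where "mtrace A = qadd (m11 A) (m22 A)"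

definition Ggrp :: "'a::field \<Rightarrow> 'a m2 set" where
  "Ggrp eps = {g. mmul eps (mmul eps (mconjT g) mw) g = mw}"

definition Kgrp :: "('a::field \<Rightarrow> int) \<Rightarrow> 'a \<Rightarrow> 'a m2 set" where
  "Kgrp nu eps = {g \<in> Ggrp eps. in_pE nu 0 (m11 g) \<and> in_pE nu 0 (m12 g)
                               \<and> in_pE nu 0 (m21 g) \<and> in_pE nu 0 (m22 g)}"

definition Kfilt :: "('a::field \<Rightarrow> int) \<Rightarrow> 'a \<Rightarrow> nat \<Rightarrow> 'a m2 set" where
  "Kfilt nu eps n = {g \<in> Ggrp eps. in_pE nu (int n) (qsub (m11 g) qone) \<and> in_pE nu (int n) (m12 g)
                               \<and> in_pE nu (int n) (m21 g) \<and> in_pE nu (int n) (qsub (m22 g) qone)}"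

text \<open>J_d, with ceil(d/2) = (d+1) div 2 and ceil((d+1)/2) = (d+2) div 2\<close>
definition Jgrp :: "('a::field \<Rightarrow> int) \<Rightarrow> 'a \<Rightarrow> nat \<Rightarrow> 'a m2 set" where
  "Jgrp nu eps d = {g \<in> Ggrp eps.
      in_pE nu (int ((d + 1) div 2)) (qsub (m11 g) qone) \<and> in_pE nu (int ((d + 1) div 2)) (m12 g)
    \<and> in_pE nu (int ((d + 2) div 2)) (m21 g) \<and> in_pE nu (int ((d + 1) div 2)) (qsub (m22 g) qone)}"

definition Tcent :: "('a::field \<Rightarrow> int) \<Rightarrow> 'a \<Rightarrow> 'a m2 \<Rightarrow> 'a m2 set" where
  "Tcent nu eps X = {k \<in> Kgrp nu eps. mmul eps k X = mmul eps X k}"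

text \<open>psi(x) = psi'((x + conj x)/2) = psi'(re x); Psi_X(k) = psi(Tr(X(k - I)))\<close>
definition PsiX :: "'a::field \<Rightarrow> ('a \<Rightarrow> complex) \<Rightarrow> 'a m2 \<Rightarrow> 'a m2 \<Rightarrow> complex" where
  "PsiX eps psi' X k = psi' (re (mtrace (mmul eps X (msub k mid))))"

definition setprod :: "'a::field \<Rightarrow> 'a m2 set \<Rightarrow> 'a m2 set \<Rightarrow> 'a m2 set" where
  "setprod eps A B = {mmul eps a b | a b. a \<in> A \<and> b \<in> B}"

definition is_character :: "'a::field \<Rightarrow> 'a m2 set \<Rightarrow> ('a m2 \<Rightarrow> complex) \<Rightarrow> bool" where
  "is_character eps H chi \<longleftrightarrow>
     (\<forall>a\<in>H. \<forall>b\<in>H. chi (mmul eps a b) = chi a * chi b) \<and> (\<forall>a\<in>H. chi a \<noteq> 0)"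

definition ind_space :: "'a::field \<Rightarrow> 'a m2 set \<Rightarrow> 'a m2 set \<Rightarrow> ('a m2 \<Rightarrow> complex) \<Rightarrow> ('a m2 \<Rightarrow> complex) set" where
  "ind_space eps K H chi = {f. (\<forall>k. k \<notin> K \<longrightarrow> f k = 0) \<and>
                               (\<forall>h\<in>H. \<forall>k\<in>K. f (mmul eps h k) = chi h * f k)}"

definition ract :: "'a::field \<Rightarrow> 'a m2 \<Rightarrow> ('a m2 \<Rightarrow> complex) \<Rightarrow> ('a m2 \<Rightarrow> complex)" where
  "ract eps k f = (\<lambda>x. f (mmul eps x k))"

definition cscale :: "complex \<Rightarrow> ('b \<Rightarrow> complex) \<Rightarrow> ('b \<Rightarrow> complex)" where
  "cscale c f = (\<lambda>x. c * f x)"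

definition irreducible_rep :: "'a::field \<Rightarrow> 'a m2 set \<Rightarrow> ('a m2 \<Rightarrow> complex) set \<Rightarrow> bool" where
  "irreducible_rep eps K V \<longleftrightarrow> V \<noteq> {0} \<and>
     (\<forall>W. module.subspace cscale W \<and> W \<subseteq> V \<and> (\<forall>k\<in>K. \<forall>f\<in>W. ract eps k f \<in> W)
          \<longrightarrow> W = {0} \<or> W = V)"

definition rep_degree :: "('a m2 \<Rightarrow> complex) set \<Rightarrow> nat" where
  "rep_degree V = vector_space.dim cscale V"

definition acts_trivially :: "'a::field \<Rightarrow> 'a m2 set \<Rightarrow> ('a m2 \<Rightarrow> complex) set \<Rightarrow> bool" where
  "acts_trivially eps S V \<longleftrightarrow> (\<forall>k\<in>S. \<forall>f\<in>V. ract eps k f = f)"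

text \<open>Depth: least r >= 0 such that the representation factors through K/K_{r+},
where K_{r+} = K_{floor r + 1}.\<close>
definition rep_depth :: "('a::field \<Rightarrow> int) \<Rightarrow> 'a \<Rightarrow> ('a m2 \<Rightarrow> complex) set \<Rightarrow> real" where
  "rep_depth nu eps V = Inf {r::real. 0 \<le> r \<and> acts_trivially eps (Kfilt nu eps (nat (\<lfloor>r\<rfloor> + 1))) V}"

end

theory Submission
  imports Defs
begin

text \<open>
  Write \<open>X = z \<surd>\<epsilon> + u \<surd>\<epsilon> X\<^sub>w\<close> with \<open>X\<^sub>w = (0, 1; w, 0)\<close> and \<open>w = v / u\<close> in the maximal ideal, and
  let \<open>a = \<lceil>d/2\<rceil>\<close>, \<open>b = \<lceil>(d+1)/2\<rceil>\<close>, so that \<open>a + b = d + 1\<close>. For \<open>g\<close> in the unitary group,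
  \<open>g\<^sup>-\<^sup>1 X\<^sub>w g = (x \<surd>\<epsilon>, y; t, - x \<surd>\<epsilon>)\<close> with \<open>x, y, t\<close> in \<open>F\<close> and \<open>y t = w - \<epsilon> x\<^sup>2\<close>.
  In these coordinates \<open>T(X) J\<^sub>d\<close> is the set of \<open>g\<close> in \<open>K\<close> with \<open>x \<in> p\<^sup>b\<close> and \<open>y \<in> 1 + p\<^sup>a\<close>.

  Cosets \<open>T(X) J\<^sub>d g\<close> with \<open>y\<close> a unit are classified by \<open>y\<close> modulo \<open>p\<^sup>a\<close> and \<open>x / y\<close> modulo \<open>p\<^sup>b\<close>; the
  others have \<open>x / t\<close> in \<open>p\<close> and are moved into this chart by the Weyl element. Since norms from the
  unramified extension hit all units, every value occurs, which gives the degree.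

  For irreducibility, take a vector of minimal support, nonzero at \<open>1\<close>, in an invariant subspace.
  Minimality forces \<open>\<Psi>\<^sub>X(g n g\<^sup>-\<^sup>1) = \<Psi>\<^sub>X(n)\<close> for \<open>g\<close> in the support, first for \<open>n\<close> in the normal
  subgroup \<open>K\<^sub>b\<close>, which makes \<open>g\<close> upper triangular modulo \<open>p\<close>, and then for all \<open>n\<close> in \<open>J\<^sub>d\<close>, which
  such \<open>g\<close> normalise. This puts \<open>g\<close> in \<open>T(X) J\<^sub>d\<close>, so the vector is the standard generator.
\<close>

section \<open>Matrices over the quadratic extension\<close>

definition qnorm :: "'a::field \<Rightarrow> 'a qe \<Rightarrow> 'a" where
  "qnorm eps x = re x * re x - eps * im x * im x"

definition madd :: "'a::field m2 \<Rightarrow> 'a m2 \<Rightarrow> 'a m2" where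
  "madd A B = M2 (qadd (m11 A) (m11 B)) (qadd (m12 A) (m12 B))
                 (qadd (m21 A) (m21 B)) (qadd (m22 A) (m22 B))"

definition msmul :: "'a::field \<Rightarrow> 'a qe \<Rightarrow> 'a m2 \<Rightarrow> 'a m2" where
  "msmul eps c A = M2 (qmul eps c (m11 A)) (qmul eps c (m12 A)) (qmul eps c (m21 A)) (qmul eps c (m22 A))"

definition mzero :: "'a::field m2" where "mzero = M2 qzero qzero qzero qzero"

text \<open>\<^term>\<open>madj\<close> is the involution \<open>mw g\<^sup>* mw\<close>, so that \<open>G\<close> consists of the
  matrices whose inverse is their image under it.\<close>
definition madj :: "'a::field m2 \<Rightarrow> 'a m2" where
  "madj A = M2 (qconj (m22 A)) (qconj (m12 A)) (qconj (m21 A)) (qconj (m11 A))"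

definition mdet :: "'a::field \<Rightarrow> 'a m2 \<Rightarrow> 'a qe" where
  "mdet eps A = qsub (qmul eps (m11 A) (m22 A)) (qmul eps (m12 A) (m21 A))"

definition mcof :: "'a::field m2 \<Rightarrow> 'a m2" where
  "mcof A = M2 (m22 A) (qsub qzero (m12 A)) (qsub qzero (m21 A)) (m11 A)"

lemmas q_defs = qadd_def qsub_def qmul_def qconj_def qzero_def qone_def
lemmas m_defs = mmul_def msub_def madd_def msmul_def mid_def mzero_def mtrace_def madj_def

lemma mmul_assoc: "mmul eps (mmul eps A B) C = mmul eps A (mmul eps B C)"
  by (simp add: mmul_def q_defs algebra_simps)

lemma mmul_mid [simp]: "mmul eps A mid = A" "mmul eps mid A = A"
  by (cases A; simp add: m_defs q_defs)+

lemma mmul_msub_right: "mmul eps A (msub B C) = msub (mmul eps A B) (mmul eps A C)"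
  by (simp add: m_defs q_defs algebra_simps)

lemma mmul_msub_left: "mmul eps (msub B C) A = msub (mmul eps B A) (mmul eps C A)"
  by (simp add: m_defs q_defs algebra_simps)

lemma mmul_madd_right: "mmul eps A (madd B C) = madd (mmul eps A B) (mmul eps A C)"
  by (simp add: m_defs q_defs algebra_simps)

lemma mmul_madd_left: "mmul eps (madd B C) A = madd (mmul eps B A) (mmul eps C A)"
  by (simp add: m_defs q_defs algebra_simps)

lemma msub_chain: "madd (msub A B) (msub B C) = msub A C"
  by (simp add: m_defs q_defs algebra_simps)

lemma msub_swap: "msub A B = msub mzero (msub B A)"
  by (simp add: m_defs q_defs algebra_simps)

lemma msub_self [simp]: "msub A A = mzero"
  by (simp add: m_defs q_defs)

lemma msub_eq_mzero: "msub A B = mzero \<Longrightarrow> A = B"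
  by (cases A; cases B; simp add: m_defs q_defs qe.expand)

lemma madd_msub_cancel: "madd B (msub A B) = A"
  by (cases A; simp add: m_defs q_defs)

lemma msmul_mmul: "mmul eps (msmul eps c A) B = msmul eps c (mmul eps A B)"
  "mmul eps A (msmul eps c B) = msmul eps c (mmul eps A B)"
  by (simp_all add: m_defs q_defs algebra_simps)

lemma msmul_msmul: "msmul eps c (msmul eps e A) = msmul eps (qmul eps c e) A"
  by (simp add: m_defs q_defs algebra_simps)

lemma msmul_qone [simp]: "msmul eps qone A = A"
  by (cases A; simp add: m_defs q_defs)

lemma msmul_mzero [simp]: "msmul eps c mzero = mzero"
  by (simp add: m_defs q_defs)

lemma madj_mmul: "madj (mmul eps A B) = mmul eps (madj B) (madj A)"
  by (simp add: m_defs q_defs algebra_simps)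

lemma madj_madj [simp]: "madj (madj A) = A"
  by (cases A; simp add: m_defs q_defs)

lemma madj_mid [simp]: "madj mid = mid"
  by (simp add: m_defs q_defs)

lemma mtrace_mmul_commute: "mtrace (mmul eps A B) = mtrace (mmul eps B A)"
  by (simp add: m_defs q_defs algebra_simps)

lemma mdet_mmul: "mdet eps (mmul eps A B) = qmul eps (mdet eps A) (mdet eps B)"
  by (simp add: mdet_def mmul_def q_defs algebra_simps)

lemma mmul_mcof: "mmul eps A (mcof A) = msmul eps (mdet eps A) mid"
  by (simp add: mdet_def mcof_def m_defs q_defs algebra_simps)

text \<open>The adjugate argument, using only commutative arithmetic in \<open>E\<close>:
  \<open>mdet B * mdet A = 1\<close>, and computing \<open>B A (mcof A)\<close> in two ways shows
  that \<open>B\<close> is \<open>mcof A\<close> scaled by \<open>mdet B\<close>.\<close>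

lemma mmul_left_inverse_imp_right:
  assumes BA: "mmul eps B A = mid"
  shows "mmul eps A B = mid"
proof -
  have det: "qmul eps (mdet eps B) (mdet eps A) = qone"
    using mdet_mmul[of eps B A] BA by (simp add: mdet_def m_defs q_defs)
  have "mcof A = mmul eps B (mmul eps A (mcof A))"
    by (simp flip: mmul_assoc add: BA)
  also have "\<dots> = msmul eps (mdet eps A) B"
    by (simp add: mmul_mcof msmul_mmul)
  finally have "msmul eps (mdet eps B) (mcof A) = B"
    using det by (simp add: msmul_msmul)
  then have "mmul eps A B = msmul eps (mdet eps B) (mmul eps A (mcof A))"
    by (metis msmul_mmul(2))
  then show ?thesis
    using det by (simp add: mmul_mcof msmul_msmul)
qed

text \<open>Since \<open>mw\<close> is an involution, multiplying the defining equation by it on the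
  left gives \<open>madj g * g = mid\<close>, so inverses in \<open>G\<close> are explicit.\<close>

lemma Ggrp_iff: "g \<in> Ggrp eps \<longleftrightarrow> mmul eps (madj g) g = mid"
proof -
  have *: "mmul eps mw (mmul eps (mmul eps (mconjT g) mw) g) = mmul eps (madj g) g"
    by (simp add: mw_def mconjT_def m_defs q_defs algebra_simps)
  have ww: "mmul eps mw mw = mid"
    by (simp add: mw_def m_defs q_defs)
  show ?thesis
    unfolding Ggrp_def using * ww by (metis (mono_tags, lifting) mem_Collect_eq mmul_assoc mmul_mid)
qed

lemma Ggrp_left_inverse [simp]: "g \<in> Ggrp eps \<Longrightarrow> mmul eps (madj g) g = mid"
  by (simp add: Ggrp_iff)

lemma Ggrp_right_inverse [simp]: "g \<in> Ggrp eps \<Longrightarrow> mmul eps g (madj g) = mid"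
  by (metis Ggrp_iff mmul_left_inverse_imp_right)

lemma Ggrp_cancel [simp]:
  assumes "g \<in> Ggrp eps"
  shows "mmul eps (madj g) (mmul eps g A) = A" "mmul eps g (mmul eps (madj g) A) = A"
  using assms by (simp_all flip: mmul_assoc)

lemma Ggrp_mid [simp]: "mid \<in> Ggrp eps"
  by (simp add: Ggrp_iff)

lemma Ggrp_mmul [simp]: "g \<in> Ggrp eps \<Longrightarrow> h \<in> Ggrp eps \<Longrightarrow> mmul eps g h \<in> Ggrp eps"
  unfolding Ggrp_iff by (metis madj_mmul mmul_assoc mmul_mid(2))

lemma Ggrp_madj [simp]: "g \<in> Ggrp eps \<Longrightarrow> madj g \<in> Ggrp eps"
  by (metis Ggrp_iff Ggrp_right_inverse madj_madj)

lemma msub_conj: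
  assumes "g \<in> Ggrp eps"
  shows "msub (mmul eps (mmul eps g n) (madj g)) mid = mmul eps (mmul eps g (msub n mid)) (madj g)"
  using assms by (simp add: mmul_msub_right mmul_msub_left)

text \<open>Cyclicity of the trace moves the conjugation from the argument \<open>n\<close> onto
  \<open>X\<close>.\<close>

lemma PsiX_conj:
  assumes "g \<in> Ggrp eps"
  shows "PsiX eps psi' X (mmul eps (mmul eps g n) (madj g)) =
    psi' (re (mtrace (mmul eps (mmul eps (madj g) (mmul eps X g)) (msub n mid))))"
  unfolding PsiX_def msub_conj[OF assms]
  by (metis mmul_assoc mtrace_mmul_commute)

section \<open>Local fields of odd residual characteristic\<close>

lemma ex_transversal: "\<exists>R. R \<subseteq> A \<and> inj_on f R \<and> f ` A = f ` R"
  by (rule subset_image_inj[THEN iffD1, OF order_refl])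

locale odd_local_field =
  fixes nu :: "'a::field \<Rightarrow> int" and p q :: nat
  assumes local_field: "nonarch_local_field nu p q"
    and p_neq_2: "p \<noteq> 2"
begin

abbreviation "O\<^sub>F \<equiv> {x. vge nu 0 x}"

lemmas local_field_axioms = local_field[unfolded nonarch_local_field_def]

section \<open>Arithmetic of the valuation\<close>

lemma nu_mult: "x \<noteq> 0 \<Longrightarrow> y \<noteq> 0 \<Longrightarrow> nu (x * y) = nu x + nu y"
  using local_field_axioms[THEN conjunct1] by simp

lemma nu_add: "x \<noteq> 0 \<Longrightarrow> y \<noteq> 0 \<Longrightarrow> x + y \<noteq> 0 \<Longrightarrow> nu (x + y) \<ge> min (nu x) (nu y)"
  using local_field_axioms[THEN conjunct2, THEN conjunct1] by simp

lemma ex_uniformizer: "\<exists>w. w \<noteq> 0 \<and> nu w = 1"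
  using local_field_axioms[THEN conjunct2, THEN conjunct2, THEN conjunct1] .

lemma complete:
  fixes s :: "nat \<Rightarrow> 'a"
  assumes "\<And>N. \<exists>M. \<forall>m\<ge>M. \<forall>n\<ge>M. vge nu N (s m - s n)"
  shows "\<exists>L. \<forall>N. \<exists>M. \<forall>n\<ge>M. vge nu N (s n - L)"
  using assms local_field_axioms[THEN conjunct2, THEN conjunct2, THEN conjunct2, THEN conjunct1]
  by blast

lemma finite_residues: "finite (O\<^sub>F // residue_rel nu)"
  and card_residues: "card (O\<^sub>F // residue_rel nu) = q"
  and prime_p: "prime p"
  and vge_p: "vge nu 1 (of_nat p)"
  using local_field_axioms[THEN conjunct2, THEN conjunct2, THEN conjunct2, THEN conjunct2] by simp_all

lemma nu_1 [simp]: "nu 1 = 0"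
  using nu_mult[of 1 1] by simp

lemma nu_minus [simp]: "nu (- x) = nu x"
proof (cases "x = 0")
  case False
  have "nu (-1) = 0" using nu_mult[of "-1" "-1"] by simp
  then show ?thesis using nu_mult[of "-1" x] False by simp
qed simp

lemma nu_inverse: "x \<noteq> 0 \<Longrightarrow> nu (inverse x) = - nu x"
  using nu_mult[of x "inverse x"] by simp

lemma nu_divide: "x \<noteq> 0 \<Longrightarrow> y \<noteq> 0 \<Longrightarrow> nu (x / y) = nu x - nu y"
  using nu_mult[of x "inverse y"] nu_inverse[of y] by (simp add: divide_inverse)

lemma vge_zero [simp]: "vge nu n 0"
  by (simp add: vge_def)

lemma vge_one [simp]: "vge nu n 1 \<longleftrightarrow> n \<le> 0"
  by (simp add: vge_def)

lemma vge_mono: "vge nu n x \<Longrightarrow> m \<le> n \<Longrightarrow> vge nu m x"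
  by (auto simp: vge_def)

lemma vge_add: "vge nu n x \<Longrightarrow> vge nu n y \<Longrightarrow> vge nu n (x + y)"
  using nu_add[of x y] by (cases "x = 0"; cases "y = 0"; cases "x + y = 0") (simp_all add: vge_def)

lemma vge_uminus [simp]: "vge nu n (- x) \<longleftrightarrow> vge nu n x"
  by (simp add: vge_def)

lemma vge_diff: "vge nu n x \<Longrightarrow> vge nu n y \<Longrightarrow> vge nu n (x - y)"
  using vge_add[of n x "- y"] by simp

lemma vge_diff_commute: "vge nu n (x - y) \<longleftrightarrow> vge nu n (y - x)"
  using vge_uminus[of n "x - y"] by simp

lemma vge_add_cancel: "vge nu n y \<Longrightarrow> vge nu n (x + y) \<longleftrightarrow> vge nu n x"
  using vge_add[of n x y] vge_diff[of n "x + y" y] by auto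

lemma vge_diff_cancel: "vge nu n y \<Longrightarrow> vge nu n (x - y) \<longleftrightarrow> vge nu n x"
  using vge_add_cancel[of n "- y" x] by simp

lemma vge_mult: "vge nu m x \<Longrightarrow> vge nu n y \<Longrightarrow> k \<le> m + n \<Longrightarrow> vge nu k (x * y)"
  using nu_mult[of x y] by (cases "x = 0"; cases "y = 0") (simp_all add: vge_def)

lemma vge_cancel_left: "x \<noteq> 0 \<Longrightarrow> vge nu n (x * y) \<longleftrightarrow> vge nu (n - nu x) y"
  using nu_mult[of x y] by (cases "y = 0") (auto simp: vge_def)

lemma vge_divide: "y \<noteq> 0 \<Longrightarrow> vge nu n (x / y) \<longleftrightarrow> vge nu (n + nu y) x"
  using nu_divide[of x y] by (cases "x = 0") (auto simp: vge_def)

lemma vge_of_nat: "vge nu 0 (of_nat n)"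
  by (induction n) (auto intro: vge_add)

definition unit :: "'a \<Rightarrow> bool" where "unit x \<longleftrightarrow> x \<noteq> 0 \<and> nu x = 0"

lemma unit_iff: "unit x \<longleftrightarrow> vge nu 0 x \<and> \<not> vge nu 1 x"
  by (auto simp: unit_def vge_def)

lemma unit_vge: "unit x \<Longrightarrow> vge nu 0 x"
  by (simp add: unit_iff)

lemma unit_nonzero: "unit x \<Longrightarrow> x \<noteq> 0"
  by (simp add: unit_def)

lemma unit_mult: "unit x \<Longrightarrow> unit y \<Longrightarrow> unit (x * y)"
  by (simp add: unit_def nu_mult)

lemma vge_unit_left: "unit x \<Longrightarrow> vge nu n (x * y) \<longleftrightarrow> vge nu n y"
  by (simp add: vge_cancel_left unit_def)

lemma vge_unit_divide: "unit y \<Longrightarrow> vge nu n (x / y) \<longleftrightarrow> vge nu n x"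
  by (simp add: vge_divide unit_def)

lemma unit_congruent: "unit x \<Longrightarrow> vge nu 1 (y - x) \<Longrightarrow> unit y"
  using vge_add_cancel[of 1 "y - x" x] vge_add[of 0 "y - x" x] vge_mono[of 1 "y - x" 0]
  by (auto simp: unit_iff)

lemma vge_ideal_prime: "vge nu 0 x \<Longrightarrow> vge nu 0 y \<Longrightarrow> vge nu 1 (x * y) \<Longrightarrow> vge nu 1 x \<or> vge nu 1 y"
  using unit_mult unit_iff by blast

text \<open>As \<open>p = 2 * k + 1\<close> lies in the maximal ideal, having 2 there as well would
  put 1 there.\<close>

lemma unit_2: "unit 2"
proof -
  have "odd p"
    using prime_p p_neq_2 prime_odd_nat prime_ge_2_nat by (metis order_le_less)
  then obtain k where "p = 2 * k + 1" by (elim oddE)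
  then have "of_nat p - 2 * of_nat k = (1::'a)" by simp
  moreover have "vge nu 1 (2::'a) \<Longrightarrow> vge nu 1 (of_nat p - 2 * of_nat k)"
    by (intro vge_diff vge_p vge_mult[of 1 _ 0] vge_of_nat) auto
  ultimately have "\<not> vge nu 1 2" by fastforce
  with vge_of_nat[of 2] show ?thesis by (simp add: unit_iff)
qed

lemma eq_if_vge_diff:
  assumes "\<And>n. vge nu n (x - y)"
  shows "x = y"
  using assms[of "nu (x - y) + 1"] by (simp add: vge_def)

text \<open>The square root is \<open>1 + t\<close> with \<open>t\<close> the fixed point of the contraction
  \<open>t \<mapsto> (x - t\<^sup>2) / 2\<close>.\<close>
lemma hensel_sqrt:
  assumes x: "vge nu n x" and n: "n \<ge> 1"
  shows "\<exists>c. c * c = 1 + x \<and> vge nu n (c - 1)"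
proof -
  define \<phi> where "\<phi> t = (x - t * t) / 2" for t
  define s where "s k = (\<phi> ^^ k) 0" for k
  have s_Suc: "s (Suc k) = \<phi> (s k)" for k by (simp add: s_def)
  have two: "(2::'a) \<noteq> 0" using unit_2 by (simp add: unit_def)
  have s_n: "vge nu n (s k)" for k
  proof (induction k)
    case 0 show ?case by (simp add: s_def)
  next
    case (Suc k)
    have "vge nu n (s k * s k)" using n by (intro vge_mult[OF Suc Suc]) simp
    then show ?case unfolding s_Suc \<phi>_def vge_unit_divide[OF unit_2] by (rule vge_diff[OF x])
  qed
  \<comment> \<open>Difference of squares: the factor \<open>t + t'\<close> lies in the maximal
    ideal and gains one power of the uniformiser.\<close>
  have contract: "vge nu (m + 1) (\<phi> t - \<phi> t')"
    if "vge nu 1 t" "vge nu 1 t'" "vge nu m (t - t')" for t t' m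
  proof -
    have eq: "\<phi> t - \<phi> t' = - ((t - t') * (t + t')) / 2" unfolding \<phi>_def by (simp add: algebra_simps flip: diff_divide_distrib)
    have "vge nu (m + 1) ((t - t') * (t + t'))"
      by (rule vge_mult[OF that(3) vge_add[OF that(1,2)]]) simp
    then show ?thesis unfolding eq vge_unit_divide[OF unit_2] by simp
  qed
  have s_1: "vge nu 1 (s k)" for k using s_n n vge_mono by blast
  have step: "vge nu (int k) (s (Suc k) - s k)" for k
  proof (induction k)
    case 0 show ?case using s_1[of 1] vge_mono[of 1 "s 1" 0] by (simp add: s_def)
  next
    case (Suc k)
    show ?case using contract[OF s_1 s_1 Suc] by (simp add: s_Suc add.commute)
  qed
  have tail: "vge nu (int k) (s (k + j) - s k)" for k j
  proof (induction j)
    case (Suc j)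
    have "vge nu (int k) (s (Suc (k + j)) - s (k + j) + (s (k + j) - s k))"
      by (rule vge_add[OF vge_mono[OF step] Suc]) simp
    then show ?case by simp
  qed simp
  have "\<exists>L. \<forall>N. \<exists>M. \<forall>k\<ge>M. vge nu N (s k - L)"
  proof (rule complete)
    fix N :: int
    have "vge nu N (s i - s j)" if "i \<ge> nat N" "j \<ge> nat N" for i j
    proof -
      have "vge nu N (s i - s (nat N))" "vge nu N (s j - s (nat N))"
        using that tail[of "nat N" "i - nat N"] tail[of "nat N" "j - nat N"] vge_mono by auto
      from vge_diff[OF this] show ?thesis by simp
    qed
    then show "\<exists>M. \<forall>m\<ge>M. \<forall>n\<ge>M. vge nu N (s m - s n)" by blast
  qed
  then obtain L where L: "\<And>N. \<exists>M. \<forall>k\<ge>M. vge nu N (s k - L)" by blast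
  have L_n: "vge nu n L"
  proof -
    obtain M where "vge nu n (s M - L)" using L[of n] by blast
    from vge_diff[OF s_n[of M] this] show ?thesis by simp
  qed
  have L_1: "vge nu 1 L" using L_n n vge_mono by blast
  \<comment> \<open>Both sides agree to every precision \<open>N\<close>: far out,
    \<open>s (Suc k)\<close> is close to \<open>L\<close> and, by contraction, to the image of
    \<open>L\<close>.\<close>
  have "L = \<phi> L"
  proof (rule eq_if_vge_diff)
    fix N
    obtain M where M: "\<And>k. k \<ge> M \<Longrightarrow> vge nu N (s k - L)" using L[of N] by blast
    have "vge nu N (\<phi> (s M) - \<phi> L)"
      using contract[OF s_1 L_1 M[of M]] vge_mono by fastforce
    with M[of "Suc M"] show "vge nu N (L - \<phi> L)"
      using vge_diff[of N "\<phi> (s M) - \<phi> L" "s (Suc M) - L"] by (simp add: s_Suc)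
  qed
  then have "2 * L = x - L * L" using two by (simp add: \<phi>_def field_simps)
  then have "(1 + L) * (1 + L) = 1 + x" by (simp add: algebra_simps)
  moreover have "vge nu n (1 + L - 1)" using L_n by simp
  ultimately show ?thesis by blast
qed

section \<open>Residue classes modulo powers of the maximal ideal\<close>

definition res :: "int \<Rightarrow> 'a \<Rightarrow> 'a set" where
  "res n x = {y. vge nu n (x - y)}"

lemma res_eq_iff: "res n x = res n y \<longleftrightarrow> vge nu n (x - y)"
proof
  assume "res n x = res n y"
  moreover have "y \<in> res n y" by (simp add: res_def)
  ultimately have "y \<in> res n x" by simp
  then show "vge nu n (x - y)" by (simp add: res_def)
next
  assume xy: "vge nu n (x - y)"
  have "vge nu n (x - t) \<longleftrightarrow> vge nu n (y - t)" for t
    using vge_add[OF xy, of "y - t"] vge_diff[OF _ xy, of "x - t"] by auto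
  then show "res n x = res n y" by (simp add: res_def)
qed

lemma card_res_1: "finite (res 1 ` O\<^sub>F)" "card (res 1 ` O\<^sub>F) = q"
proof -
  have rel: "residue_rel nu `` {x} = res 1 x" if "x \<in> O\<^sub>F" for x
  proof -
    have "vge nu 0 y" if "vge nu 1 (x - y)" for y
      using vge_diff[of 0 x "x - y"] vge_mono[OF that, of 0] \<open>x \<in> O\<^sub>F\<close> by simp
    with that show ?thesis by (auto simp: residue_rel_def res_def)
  qed
  have "O\<^sub>F // residue_rel nu = res 1 ` O\<^sub>F"
    unfolding quotient_def using rel by auto
  then show "finite (res 1 ` O\<^sub>F)" "card (res 1 ` O\<^sub>F) = q"
    using finite_residues card_residues by auto
qed

text \<open>Digit expansion: modulo \<open>p^(n+1)\<close> every integer is \<open>s + w * r\<close>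
  with \<open>s\<close> determined modulo \<open>p\<close> and \<open>r\<close> modulo
  \<open>p^n\<close>, where \<open>w\<close> is a uniformiser.\<close>

lemma card_res: "finite (res (int n) ` O\<^sub>F)" "card (res (int n) ` O\<^sub>F) = q ^ n"
proof -
  have "finite (res (int n) ` O\<^sub>F) \<and> card (res (int n) ` O\<^sub>F) = q ^ n"
  proof (induction n)
    case 0
    have "res 0 ` O\<^sub>F = {res 0 0}"
      using res_eq_iff[of 0 _ 0] by (auto simp: image_iff intro!: exI[of _ 0])
    then show ?case by simp
  next
    case (Suc n)
    obtain w where w: "w \<noteq> 0" "nu w = 1" using ex_uniformizer by blast
    obtain S where S: "S \<subseteq> O\<^sub>F" "inj_on (res 1) S" "res 1 ` O\<^sub>F = res 1 ` S"
      using ex_transversal by (metis (lifting))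
    obtain R where R: "R \<subseteq> O\<^sub>F" "inj_on (res (int n)) R" "res (int n) ` O\<^sub>F = res (int n) ` R"
      using ex_transversal by (metis (lifting))
    have cS: "finite S" "card S = q"
      by (metis S(2,3) card_res_1(1) finite_image_iff, metis S(2,3) card_res_1(2) card_image)
    have cR: "finite R" "card R = q ^ n"
      by (metis R(2,3) Suc finite_image_iff, metis R(2,3) Suc card_image)
    define h where "h = (\<lambda>(s, r). res (int (Suc n)) (s + w * r))"
    have "inj_on h (S \<times> R)"
    proof (rule inj_onI, clarsimp simp: h_def)
      fix s r s' r' assume *: "s \<in> S" "r \<in> R" "s' \<in> S" "r' \<in> R"
        "res (1 + int n) (s + w * r) = res (1 + int n) (s' + w * r')"
      have d: "vge nu (1 + int n) ((s - s') + w * (r - r'))"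
        using *(5) by (simp add: res_eq_iff algebra_simps)
      have "vge nu 0 (r - r')" using * R by (intro vge_diff) auto
      then have "vge nu 1 (w * (r - r'))" using w by (simp add: vge_cancel_left)
      with vge_mono[OF d, of 1] have "vge nu 1 (s - s')" using vge_add_cancel by auto
      then have "s = s'" using * S by (auto simp: res_eq_iff inj_on_def)
      with d w have "vge nu (int n) (r - r')" by (simp add: vge_cancel_left)
      then show "s = s' \<and> r = r'" using * R \<open>s = s'\<close> by (auto simp: res_eq_iff inj_on_def)
    qed
    then have c: "card (h ` (S \<times> R)) = q ^ Suc n" and f: "finite (h ` (S \<times> R))"
      using cS cR by (simp_all add: card_image)
    have "h ` (S \<times> R) = res (int (Suc n)) ` O\<^sub>F"
    proof
      have "s + w * r \<in> O\<^sub>F" if "s \<in> S" "r \<in> R" for s r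
        using that S R w by (auto intro!: vge_add vge_mult[of 1 w 0] simp: vge_def[of nu 1 w])
      then show "h ` (S \<times> R) \<subseteq> res (int (Suc n)) ` O\<^sub>F"
        unfolding h_def by (auto intro!: imageI)
      show "res (int (Suc n)) ` O\<^sub>F \<subseteq> h ` (S \<times> R)"
      proof clarify
        fix x assume x: "vge nu 0 x"
        then obtain s where s: "s \<in> S" "res 1 x = res 1 s" using S(3) by (metis imageE imageI mem_Collect_eq)
        define y where "y = (x - s) / w"
        have y: "vge nu 0 y" using s w by (simp add: y_def res_eq_iff vge_divide)
        then obtain r where r: "r \<in> R" "res (int n) y = res (int n) r"
          using R(3) by (metis imageE imageI mem_Collect_eq)
        have "x - (s + w * r) = w * (y - r)" using w by (simp add: y_def field_simps)
        moreover have "vge nu (1 + int n) (w * (y - r))" using r w by (simp add: vge_cancel_left res_eq_iff)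
        ultimately have "res (int (Suc n)) x = h (s, r)" by (simp add: h_def res_eq_iff)
        with s r show "res (int (Suc n)) x \<in> h ` (S \<times> R)" by auto
      qed
    qed
    with c f show ?case by simp
  qed
  then show "finite (res (int n) ` O\<^sub>F)" "card (res (int n) ` O\<^sub>F) = q ^ n" by blast+
qed

text \<open>Multiplication by a uniformiser identifies \<open>O/p^n\<close> with
  \<open>p/p^(n+1)\<close>.\<close>

lemma card_res_maximal_ideal:
  "finite (res (int (Suc n)) ` {x. vge nu 1 x})" "card (res (int (Suc n)) ` {x. vge nu 1 x}) = q ^ n"
proof -
  obtain w where w: "w \<noteq> 0" "nu w = 1" using ex_uniformizer by blast
  have img: "{x. vge nu 1 x} = (*) w ` O\<^sub>F"
  proof (intro equalityI subsetI)
    fix x assume "x \<in> {x. vge nu 1 x}"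
    then have "vge nu 0 (x / w)" "x = w * (x / w)" using w by (simp_all add: vge_divide)
    then show "x \<in> (*) w ` O\<^sub>F" by blast
  qed (use w in \<open>auto simp: vge_cancel_left\<close>)
  obtain R where R: "R \<subseteq> O\<^sub>F" "inj_on (res (int n)) R" "res (int n) ` O\<^sub>F = res (int n) ` R"
    using ex_transversal by (metis (lifting))
  have cR: "finite R" "card R = q ^ n"
    by (metis R(2,3) card_res(1) finite_image_iff, metis R(2,3) card_res(2) card_image)
  have eq: "res (int (Suc n)) (w * x) = res (int (Suc n)) (w * y) \<longleftrightarrow> res (int n) x = res (int n) y" for x y
    using w vge_cancel_left[of w "int (Suc n)" "x - y"] by (simp add: res_eq_iff right_diff_distrib)
  have "(\<lambda>r. res (int (Suc n)) (w * r)) ` O\<^sub>F \<subseteq> (\<lambda>r. res (int (Suc n)) (w * r)) ` R"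
  proof (rule image_subsetI)
    fix x assume "x \<in> O\<^sub>F"
    then obtain r where "r \<in> R" "res (int n) x = res (int n) r" using R(3) by blast
    then show "res (int (Suc n)) (w * x) \<in> (\<lambda>r. res (int (Suc n)) (w * r)) ` R"
      using eq by blast
  qed
  then have "res (int (Suc n)) ` {x. vge nu 1 x} = (\<lambda>r. res (int (Suc n)) (w * r)) ` R"
    unfolding img image_image using R(1) by blast
  moreover have "inj_on (\<lambda>r. res (int (Suc n)) (w * r)) R"
    using R(2) eq by (auto simp: inj_on_def)
  ultimately show "finite (res (int (Suc n)) ` {x. vge nu 1 x})"
    "card (res (int (Suc n)) ` {x. vge nu 1 x}) = q ^ n"
    using cR by (simp_all add: card_image)
qed

lemma card_res_units:
  "finite (res (int (Suc n)) ` {x. unit x})"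
  "card (res (int (Suc n)) ` {x. unit x}) = q ^ Suc n - q ^ n"
proof -
  let ?r = "res (int (Suc n))"
  have U: "O\<^sub>F = {x. unit x} \<union> {x. vge nu 1 x}"
    by (auto simp: unit_iff intro: vge_mono)
  have disj: "?r ` {x. unit x} \<inter> ?r ` {x. vge nu 1 x} = {}"
  proof -
    have False if "unit x" "vge nu 1 y" "vge nu (int (Suc n)) (x - y)" for x y
      using vge_add[OF vge_mono[OF that(3), of 1] that(2)] that(1) by (simp add: unit_iff)
    then show ?thesis by (fastforce simp: res_eq_iff)
  qed
  have split: "?r ` O\<^sub>F = ?r ` {x. unit x} \<union> ?r ` {x. vge nu 1 x}"
    by (subst U) (rule image_Un)
  then show fin: "finite (?r ` {x. unit x})"
    using card_res(1)[of "Suc n"] by simp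
  show "card (?r ` {x. unit x}) = q ^ Suc n - q ^ n"
    using card_Un_disjoint[OF fin card_res_maximal_ideal(1) disj] card_res(2)[of "Suc n"] split
    by (metis card_res_maximal_ideal(2) diff_add_inverse2)
qed

end

section \<open>Norms, lattices and congruence subgroups\<close>

locale unramified_extension = odd_local_field +
  fixes eps :: 'a
  assumes eps_unit: "unit eps"
    and eps_nonsquare: "\<not> (\<exists>y. y * y = eps)"
begin

lemma eps_vge: "vge nu 0 eps"
  by (simp add: eps_unit unit_vge)

text \<open>The norm form is anisotropic over the residue field: a nontrivial zero would make
  \<open>eps\<close> a square modulo \<open>p\<close>, hence a square by
  \<open>hensel_sqrt\<close>.\<close>

lemma qnorm_maximal_ideal:
  assumes x: "in_pE nu 0 x" and n: "vge nu 1 (qnorm eps x)"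
  shows "in_pE nu 1 x"
proof -
  let ?a = "re x" and ?b = "im x"
  have O: "vge nu 0 ?a" "vge nu 0 ?b" using x by (simp_all add: in_pE_def)
  have d: "vge nu 1 (?a * ?a - eps * ?b * ?b)" using n by (simp add: qnorm_def)
  have b: "vge nu 1 ?b"
  proof (rule ccontr)
    assume "\<not> vge nu 1 ?b"
    then have ub: "unit ?b" using O by (simp add: unit_iff)
    have "vge nu 1 (eps * ?b * ?b - ?a * ?a)" using d vge_diff_commute by blast
    then have "unit (?a * ?a)"
      using unit_congruent[of "eps * ?b * ?b" "?a * ?a"] ub eps_unit d by (simp add: unit_mult)
    then have ua: "unit ?a"
      using O(1) vge_mult[of 1 ?a 0 ?a 1] by (auto simp: unit_iff)
    \<comment> \<open>This is \<open>eps\<close> times a square and congruent to 1, so a square root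
      \<open>s\<close> of it yields the root \<open>s * re x / im x\<close> of
      \<open>eps\<close>.\<close>
    define c where "c = eps * (?b / ?a) * (?b / ?a)"
    have "c - 1 = (eps * ?b * ?b - ?a * ?a) / (?a * ?a)"
      using unit_nonzero[OF ua] by (simp add: c_def field_simps)
    then have "vge nu 1 (c - 1)"
      using vge_unit_divide[OF unit_mult[OF ua ua]] d vge_diff_commute by metis
    then obtain s where s: "s * s = 1 + (c - 1)" using hensel_sqrt[of 1 "c - 1"] by auto
    have "(s * ?a / ?b) * (s * ?a / ?b) = s * s * (?a * ?a) / (?b * ?b)" by simp
    also have "\<dots> = eps" using s unit_nonzero[OF ua] unit_nonzero[OF ub] by (simp add: c_def field_simps)
    finally show False using eps_nonsquare by blast
  qed
  have "vge nu 1 (eps * ?b * ?b)"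
    by (rule vge_mult[OF vge_mult[OF eps_vge b] b]) auto
  then have "vge nu 1 (?a * ?a)" using d vge_diff_cancel by blast
  with b O show ?thesis using vge_ideal_prime by (auto simp: in_pE_def)
qed

text \<open>Pigeonhole: more than half of the residue classes are squares, and equally many have the
  form \<open>y\<close> plus \<open>eps\<close> times a square, so the two sets meet.\<close>

lemma qnorm_residue_surj:
  assumes y: "vge nu 0 y"
  shows "\<exists>\<alpha> \<beta>. vge nu 0 \<alpha> \<and> vge nu 0 \<beta> \<and> vge nu 1 (\<alpha> * \<alpha> - eps * \<beta> * \<beta> - y)"
proof -
  obtain R where R: "R \<subseteq> O\<^sub>F" "inj_on (res 1) R" "res 1 ` O\<^sub>F = res 1 ` R"
    using ex_transversal by (metis (lifting))
  have cR: "finite R" "card R = q"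
    by (metis R(2,3) card_res_1(1) finite_image_iff, metis R(2,3) card_res_1(2) card_image)
  define f where "f r = res 1 (r * r)" for r
  define g where "g r = res 1 (y + eps * (r * r))" for r
  have fib1: "card {r \<in> R. res 1 r = c} \<le> 1" for c
    using R(2) cR(1) by (auto simp: card_le_Suc0_iff_eq inj_on_def)
  have sq: "res 1 r = res 1 s \<or> res 1 r = res 1 (- s)" if "r \<in> R" "s \<in> R" "f r = f s" for r s
  proof -
    have "vge nu 1 ((r - s) * (r + s))" using that(3) by (simp add: f_def res_eq_iff algebra_simps)
    moreover have "vge nu 0 (r - s)" "vge nu 0 (r + s)" using that R by (auto intro: vge_diff vge_add)
    ultimately show ?thesis using vge_ideal_prime[of "r - s" "r + s"] by (simp add: res_eq_iff)
  qed
  have fib2: "card {r \<in> R. f r = f s} \<le> 2" if "s \<in> R" for s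
  proof -
    have "{r \<in> R. f r = f s} \<subseteq> {r \<in> R. res 1 r = res 1 s} \<union> {r \<in> R. res 1 r = res 1 (- s)}"
      using sq that by auto
    then have "card {r \<in> R. f r = f s}
        \<le> card ({r \<in> R. res 1 r = res 1 s} \<union> {r \<in> R. res 1 r = res 1 (- s)})"
      using cR(1) by (intro card_mono) auto
    also have "\<dots> \<le> card {r \<in> R. res 1 r = res 1 s} + card {r \<in> R. res 1 r = res 1 (- s)}"
      by (rule card_Un_le)
    also have "\<dots> \<le> 2" using fib1[of "res 1 s"] fib1[of "res 1 (- s)"] by linarith
    finally show ?thesis .
  qed
  have "(0::'a) \<in> O\<^sub>F" by simp
  then obtain r0 where r0: "r0 \<in> R" "res 1 0 = res 1 r0" using R(3) by blast
  have fib0: "card {r \<in> R. f r = f r0} \<le> 1"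
  proof -
    have "res 1 r = res 1 r0" if "r \<in> R" "f r = f r0" for r
      using sq[OF that(1) r0(1) that(2)] r0(2) by (auto simp: res_eq_iff vge_add_cancel vge_diff_cancel)
    then have "{r \<in> R. f r = f r0} \<subseteq> {r \<in> R. res 1 r = res 1 r0}" by blast
    from card_mono[OF _ this] cR(1) fib1[of "res 1 r0"] show ?thesis by fastforce
  qed
  have "q = (\<Sum>c\<in>f ` R. card {r \<in> R. f r = c})"
    using cR sum.image_gen[of R "\<lambda>_. 1::nat" f] by simp
  \<comment> \<open>Strict, because the fibre of squaring above the zero class has at most one
    element while the others have at most two.\<close>
  also have "\<dots> < (\<Sum>c\<in>f ` R. 2)"
    using cR(1) fib2 fib0 r0(1) by (intro sum_strict_mono_ex1) (auto intro!: exI[of _ r0] bexI[of _ r0])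
  finally have q: "q < 2 * card (f ` R)" by simp
  have fg: "g r = g s \<longleftrightarrow> f r = f s" for r s
  proof -
    have "y + eps * (r * r) - (y + eps * (s * s)) = eps * (r * r - s * s)" by (simp add: algebra_simps)
    then show ?thesis by (simp only: f_def g_def res_eq_iff vge_unit_left[OF eps_unit])
  qed
  have "card (g ` R) = card (f ` R)"
  proof (rule bij_betw_same_card[symmetric])
    \<comment> \<open>\<open>f\<close> and \<open>g\<close> have the same fibres, so this is a
      well-defined bijection between their images.\<close>
    define h where "h c = g (inv_into R f c)" for c
    have h: "h (f r) = g r" if "r \<in> R" for r
      using that fg f_inv_into_f[of "f r" f R] by (simp add: h_def)
    then show "bij_betw h (f ` R) (g ` R)"
      using fg by (auto simp: bij_betw_def inj_on_def image_iff)
  qed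
  moreover have "f ` R \<union> g ` R \<subseteq> res 1 ` O\<^sub>F"
    using R(1) y eps_vge by (auto simp: f_def g_def intro!: imageI vge_add vge_mult[of 0 _ 0])
  then have "card (f ` R \<union> g ` R) \<le> q"
    using card_mono card_res_1 by metis
  ultimately have "f ` R \<inter> g ` R \<noteq> {}"
    using q card_Un_disjoint[of "f ` R" "g ` R"] cR(1) by auto
  then obtain \<alpha> \<beta> where "\<alpha> \<in> R" "\<beta> \<in> R" "f \<alpha> = g \<beta>" by auto
  then show ?thesis
    using R(1) by (intro exI[of _ \<alpha>] exI[of _ \<beta>]) (auto simp: f_def g_def res_eq_iff algebra_simps)
qed

text \<open>A solution modulo \<open>p\<close> has norm \<open>n\<close> with \<open>y / n\<close>
  in \<open>1 + p\<close>. Scaling it by a square root \<open>c\<close> of \<open>y / n\<close>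
  multiplies the norm by \<open>y / n\<close>.\<close>

lemma qnorm_surj:
  assumes y: "unit y"
  shows "\<exists>x. in_pE nu 0 x \<and> qnorm eps x = y"
proof -
  obtain \<alpha> \<beta> where *: "vge nu 0 \<alpha>" "vge nu 0 \<beta>" "vge nu 1 (\<alpha> * \<alpha> - eps * \<beta> * \<beta> - y)"
    using qnorm_residue_surj[OF unit_vge[OF y]] by blast
  define n where "n = \<alpha> * \<alpha> - eps * \<beta> * \<beta>"
  have n: "unit n" using unit_congruent[OF y] *(3) by (simp add: n_def)
  have "y / n - 1 = - (n - y) / n" using unit_nonzero[OF n] by (simp add: field_simps)
  moreover have "vge nu 1 (- (n - y))" using *(3) unfolding vge_uminus by (simp add: n_def)
  ultimately have "vge nu 1 (y / n - 1)" using vge_unit_divide[OF n] by metis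
  then obtain c where c: "c * c = y / n" "vge nu 1 (c - 1)" using hensel_sqrt[of 1 "y / n - 1"] by auto
  have cO: "vge nu 0 c" using vge_add[OF vge_mono[OF c(2), of 0], of 1] by simp
  have "qnorm eps (QE (c * \<alpha>) (c * \<beta>)) = c * c * n" by (simp add: qnorm_def n_def algebra_simps)
  then have "qnorm eps (QE (c * \<alpha>) (c * \<beta>)) = y" using c unit_nonzero[OF n] by simp
  moreover have "in_pE nu 0 (QE (c * \<alpha>) (c * \<beta>))"
    using *(1,2) cO by (auto simp: in_pE_def intro: vge_mult[of 0 _ 0])
  ultimately show ?thesis by blast
qed

lemma in_pE_mono: "in_pE nu n x \<Longrightarrow> m \<le> n \<Longrightarrow> in_pE nu m x"
  by (auto simp: in_pE_def intro: vge_mono)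

lemma in_pE_qadd: "in_pE nu n x \<Longrightarrow> in_pE nu n y \<Longrightarrow> in_pE nu n (qadd x y)"
  by (simp add: in_pE_def qadd_def vge_add)

lemma in_pE_qsub: "in_pE nu n x \<Longrightarrow> in_pE nu n y \<Longrightarrow> in_pE nu n (qsub x y)"
  by (simp add: in_pE_def qsub_def vge_diff)

lemma in_pE_qmul:
  assumes "in_pE nu m x" "in_pE nu n y" "k \<le> m + n"
  shows "in_pE nu k (qmul eps x y)"
proof -
  have "vge nu m (eps * im x)"
    using assms(1) by (auto simp: in_pE_def intro: vge_mult[OF eps_vge])
  with assms show ?thesis
    by (auto simp: in_pE_def qmul_def intro!: vge_add vge_mult[of m _ n])
qed

lemma in_pE_qconj [simp]: "in_pE nu n (qconj x) \<longleftrightarrow> in_pE nu n x"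
  by (simp add: in_pE_def qconj_def)

lemma in_pE_qzero [simp]: "in_pE nu n qzero"
  by (simp add: in_pE_def qzero_def)

lemma in_pE_qone [simp]: "in_pE nu n qone \<longleftrightarrow> n \<le> 0"
  by (simp add: in_pE_def qone_def)

text \<open>Separate bounds for the four entries treat \<open>K_n\<close>, \<open>J_d\<close> and
  the lattice attached to \<open>H\<close> uniformly, so that product estimates reduce to
  inequalities between exponents.\<close>

definition lat :: "int \<Rightarrow> int \<Rightarrow> int \<Rightarrow> int \<Rightarrow> 'a m2 \<Rightarrow> bool" where
  "lat e f g h A \<longleftrightarrow> in_pE nu e (m11 A) \<and> in_pE nu f (m12 A) \<and> in_pE nu g (m21 A) \<and> in_pE nu h (m22 A)"

lemma lat_mono: "lat e f g h A \<Longrightarrow> e' \<le> e \<Longrightarrow> f' \<le> f \<Longrightarrow> g' \<le> g \<Longrightarrow> h' \<le> h \<Longrightarrow> lat e' f' g' h' A"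
  by (auto simp: lat_def intro: in_pE_mono)

lemma lat_madd: "lat e f g h A \<Longrightarrow> lat e f g h B \<Longrightarrow> lat e f g h (madd A B)"
  by (simp add: lat_def madd_def in_pE_qadd)

lemma lat_msub: "lat e f g h A \<Longrightarrow> lat e f g h B \<Longrightarrow> lat e f g h (msub A B)"
  by (simp add: lat_def msub_def in_pE_qsub)

lemma lat_mzero [simp]: "lat e f g h mzero"
  by (simp add: lat_def mzero_def)

lemma lat_msub_commute: "lat e f g h (msub A B) \<Longrightarrow> lat e f g h (msub B A)"
  using lat_msub[OF lat_mzero, of e f g h "msub A B"] msub_swap by metis

lemma lat_mid [simp]: "e \<le> 0 \<Longrightarrow> h \<le> 0 \<Longrightarrow> lat e f g h mid"
  by (simp add: lat_def mid_def)

lemma lat_madj [simp]: "lat e f g h (madj A) \<longleftrightarrow> lat h f g e A"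
  by (auto simp: lat_def madj_def)

lemma lat_mmul:
  assumes "lat e1 e2 e3 e4 A" "lat f1 f2 f3 f4 B"
    and "h1 \<le> e1 + f1" "h1 \<le> e2 + f3" "h2 \<le> e1 + f2" "h2 \<le> e2 + f4"
    and "h3 \<le> e3 + f1" "h3 \<le> e4 + f3" "h4 \<le> e3 + f2" "h4 \<le> e4 + f4"
  shows "lat h1 h2 h3 h4 (mmul eps A B)"
  using assms by (auto simp: lat_def mmul_def intro!: in_pE_qadd elim: in_pE_qmul)

lemma lat_near_mid:
  assumes "lat e f g h (msub A mid)" "e \<ge> 0" "h \<ge> 0"
  shows "lat 0 f g 0 A"
proof -
  have "lat 0 f g 0 (madd mid (msub A mid))"
    using assms by (intro lat_madd lat_mono[OF assms(1)]) auto
  then show ?thesis by (simp add: madd_msub_cancel)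
qed

section \<open>The group K, its congruence filtration and J\<close>

lemma Kgrp_iff: "g \<in> Kgrp nu eps \<longleftrightarrow> g \<in> Ggrp eps \<and> lat 0 0 0 0 g"
  by (auto simp: Kgrp_def lat_def)

lemma Kfilt_iff: "g \<in> Kfilt nu eps n \<longleftrightarrow> g \<in> Ggrp eps \<and> lat n n n n (msub g mid)"
  by (auto simp: Kfilt_def lat_def msub_def mid_def qsub_def qzero_def)

lemma Jgrp_iff: "g \<in> Jgrp nu eps d \<longleftrightarrow> g \<in> Ggrp eps \<and>
    lat ((d + 1) div 2) ((d + 1) div 2) ((d + 2) div 2) ((d + 1) div 2) (msub g mid)"
  by (auto simp: Jgrp_def lat_def msub_def mid_def qsub_def qzero_def)

lemma Kgrp_Ggrp: "g \<in> Kgrp nu eps \<Longrightarrow> g \<in> Ggrp eps"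
  by (simp add: Kgrp_iff)

lemma Kgrp_mid [simp]: "mid \<in> Kgrp nu eps"
  by (simp add: Kgrp_iff)

lemma Kgrp_mmul [simp]: "g \<in> Kgrp nu eps \<Longrightarrow> h \<in> Kgrp nu eps \<Longrightarrow> mmul eps g h \<in> Kgrp nu eps"
  by (auto simp: Kgrp_iff intro: lat_mmul)

lemma Kgrp_madj [simp]: "g \<in> Kgrp nu eps \<Longrightarrow> madj g \<in> Kgrp nu eps"
  by (simp add: Kgrp_iff)

lemma Kfilt_subset_Kgrp: "g \<in> Kfilt nu eps n \<Longrightarrow> g \<in> Kgrp nu eps"
  by (auto simp: Kgrp_iff Kfilt_iff intro: lat_mono[OF lat_near_mid])

lemma Kfilt_conj:
  assumes "n \<in> Kfilt nu eps m" "g \<in> Kgrp nu eps"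
  shows "mmul eps (mmul eps g n) (madj g) \<in> Kfilt nu eps m"
proof -
  note g = assms(2)[unfolded Kgrp_iff] and n = assms(1)[unfolded Kfilt_iff]
  have "lat m m m m (mmul eps g (msub n mid))"
    by (rule lat_mmul[OF conjunct2[OF g] conjunct2[OF n]]) auto
  then have "lat m m m m (mmul eps (mmul eps g (msub n mid)) (madj g))"
    by (rule lat_mmul[of _ _ _ _ _ 0 0 0 0]) (use g in auto)
  with g n show ?thesis by (simp add: Kfilt_iff msub_conj)
qed

end

section \<open>The orbit of the nilpotent part\<close>

text \<open>The elements of \<open>G\<close> on which characters are tested. Off-diagonal entries of
  unitary unipotents are multiples of the square root of \<open>eps\<close>, since conjugation must
  negate them.\<close>

definition low :: "'a::field \<Rightarrow> 'a m2" where "low c = M2 qone qzero (QE 0 c) qone"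
definition upp :: "'a::field \<Rightarrow> 'a m2" where "upp c = M2 qone (QE 0 c) qzero qone"
definition dg :: "'a::field \<Rightarrow> 'a m2" where "dg l = M2 (QE l 0) qzero qzero (QE (1 / l) 0)"

lemma low_Ggrp: "low c \<in> Ggrp eps"
  by (simp add: Ggrp_iff low_def m_defs q_defs)

lemma upp_Ggrp: "upp c \<in> Ggrp eps"
  by (simp add: Ggrp_iff upp_def m_defs q_defs)

lemma dg_Ggrp: "l \<noteq> 0 \<Longrightarrow> dg l \<in> Ggrp eps"
  by (simp add: Ggrp_iff dg_def m_defs q_defs)

lemma mw_Ggrp: "mw \<in> Ggrp eps"
  by (simp add: Ggrp_iff mw_def m_defs q_defs)

locale nilpotent_orbit = unramified_extension +
  fixes w :: 'a and d :: nat
  assumes w: "vge nu 1 w"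
    and d: "d > 0"
begin

abbreviation a :: int where "a \<equiv> int ((d + 1) div 2)"
abbreviation b :: int where "b \<equiv> int ((d + 2) div 2)"

lemma ab: "1 \<le> a" "a \<le> b" "b \<le> a + 1" "1 \<le> b" "a + b = int d + 1"
  using d by auto

definition Xw :: "'a m2" where "Xw = M2 qzero qone (QE w 0) qzero"

definition orb :: "'a m2 \<Rightarrow> 'a m2" where "orb g = mmul eps (madj g) (mmul eps Xw g)"

definition cx :: "'a m2 \<Rightarrow> 'a" where "cx g = im (m11 (orb g))"
definition cy :: "'a m2 \<Rightarrow> 'a" where "cy g = re (m12 (orb g))"
definition ct :: "'a m2 \<Rightarrow> 'a" where "ct g = re (m21 (orb g))"

lemma two_nonzero: "(2::'a) \<noteq> 0"
  using unit_2 by (rule unit_nonzero)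

lemma self_neg_iff: "(x::'a) = - x \<longleftrightarrow> x = 0"
  using two_nonzero by (metis add.right_inverse add_cancel_right_right mult_2 mult_eq_0_iff neg_equal_0_iff_equal)

lemma madj_Xw: "madj Xw = Xw"
  by (simp add: Xw_def m_defs q_defs)

lemma orb_mid [simp]: "orb mid = Xw"
  by (simp add: orb_def)

lemma c_mid [simp]: "cx mid = 0" "cy mid = 1" "ct mid = w"
  by (simp_all add: cx_def cy_def ct_def Xw_def q_defs)

lemma orb_mmul: "orb (mmul eps g h) = mmul eps (madj h) (mmul eps (orb g) h)"
  by (simp add: orb_def madj_mmul mmul_assoc)

text \<open>\<open>Xw\<close> is fixed by the anti-involution \<open>madj\<close> and has trace 0,
  and both properties pass to \<open>orb g\<close>. As 2 is invertible, they leave only three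
  coordinates in \<open>F\<close>.\<close>

lemma orb_form:
  assumes g: "g \<in> Ggrp eps"
  shows "orb g = M2 (QE 0 (cx g)) (QE (cy g) 0) (QE (ct g) 0) (QE 0 (- cx g))"
proof -
  have "madj (orb g) = orb g"
    by (simp add: orb_def madj_mmul madj_Xw mmul_assoc)
  then have adj: "qconj (m22 (orb g)) = m11 (orb g)" "qconj (m12 (orb g)) = m12 (orb g)"
    "qconj (m21 (orb g)) = m21 (orb g)"
    by (metis m2.sel madj_def)+
  have "mtrace (orb g) = mtrace Xw"
    unfolding orb_def by (subst mtrace_mmul_commute) (simp add: mmul_assoc g)
  then have tr: "re (m11 (orb g)) + re (m22 (orb g)) = 0"
    by (simp add: mtrace_def Xw_def q_defs)
  have "im (m12 (orb g)) = - im (m12 (orb g))" "im (m21 (orb g)) = - im (m21 (orb g))"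
    "re (m22 (orb g)) = re (m11 (orb g))" "im (m22 (orb g)) = - im (m11 (orb g))"
    using adj by (metis qconj_def qe.sel minus_minus)+
  then have "im (m12 (orb g)) = 0" "im (m21 (orb g)) = 0" "re (m11 (orb g)) = 0"
    "re (m22 (orb g)) = 0" "im (m22 (orb g)) = - im (m11 (orb g))"
    using tr two_nonzero self_neg_iff by (auto simp flip: mult_2)
  then show ?thesis
    by (simp add: cx_def cy_def ct_def m2.expand qe.expand)
qed

text \<open>\<open>Xw\<close> squares to the scalar \<open>w\<close>, hence so does its conjugate.
  The relation is the upper left entry of that square.\<close>

lemma orb_det:
  assumes g: "g \<in> Ggrp eps"
  shows "cy g * ct g = w - eps * cx g * cx g"
proof -
  have "mmul eps (orb g) (orb g) = mmul eps (madj g) (mmul eps (mmul eps Xw Xw) g)"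
    by (simp add: orb_def mmul_assoc g)
  also have "mmul eps Xw Xw = msmul eps (QE w 0) mid"
    by (simp add: Xw_def m_defs q_defs)
  also have "mmul eps (madj g) (mmul eps (msmul eps (QE w 0) mid) g) = msmul eps (QE w 0) mid"
    by (simp add: msmul_mmul g)
  finally have "re (m11 (mmul eps (orb g) (orb g))) = w"
    by (simp add: m_defs q_defs)
  then show ?thesis
    by (simp add: orb_form[OF g] m_defs q_defs algebra_simps)
qed

lemma cy_eq: "cy g = qnorm eps (m22 g) + w * qnorm eps (m12 g)"
  by (simp add: cy_def orb_def Xw_def qnorm_def m_defs q_defs algebra_simps)

lemma ct_eq: "ct g = qnorm eps (m21 g) + w * qnorm eps (m11 g)"
  by (simp add: ct_def orb_def Xw_def qnorm_def m_defs q_defs algebra_simps)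

lemma qnorm_vge: "in_pE nu 0 x \<Longrightarrow> vge nu 0 (qnorm eps x)"
  unfolding qnorm_def in_pE_def by (auto intro!: vge_diff vge_mult[of 0 _ 0] eps_vge)

lemma lat_Xw: "lat 1 0 1 1 Xw"
  using w by (simp add: lat_def Xw_def qone_def[symmetric]) (simp add: in_pE_def)

lemma c_vge:
  assumes "g \<in> Kgrp nu eps"
  shows "vge nu 0 (cx g)" "vge nu 0 (cy g)" "vge nu 0 (ct g)"
proof -
  have g: "lat 0 0 0 0 g" using assms by (simp add: Kgrp_iff)
  have "lat 0 0 0 0 (mmul eps Xw g)" by (rule lat_mmul[OF lat_Xw g]) auto
  then have "lat 0 0 0 0 (orb g)"
    unfolding orb_def by (rule lat_mmul[of 0 0 0 0, rotated]) (use g in auto)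
  then show "vge nu 0 (cx g)" "vge nu 0 (cy g)" "vge nu 0 (ct g)"
    by (auto simp: lat_def in_pE_def cx_def cy_def ct_def)
qed

text \<open>By \<open>ct_eq\<close> and \<open>w\<close> in \<open>p\<close>, the norm of the lower
  left entry lies in \<open>p\<close>; anisotropy puts the entry itself there.\<close>

lemma ct_maximal_ideal:
  assumes "g \<in> Kgrp nu eps" "vge nu 1 (ct g)"
  shows "lat 0 0 1 0 g"
proof -
  have g: "lat 0 0 0 0 g" using assms by (simp add: Kgrp_iff)
  then have "vge nu 1 (w * qnorm eps (m11 g))"
    by (intro vge_mult[OF w qnorm_vge]) (auto simp: lat_def)
  then have "vge nu 1 (qnorm eps (m21 g))"
    using assms(2) vge_add_cancel by (simp add: ct_eq)
  then show ?thesis using g qnorm_maximal_ideal by (auto simp: lat_def)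
qed

text \<open>The exponents fit because \<open>a \<le> b \<le> a + 1\<close>: where an entry bounded
  only by \<open>a\<close> must reach \<open>b\<close>, it meets the lower left entry of
  \<open>g\<close> or of its inverse, which lies in \<open>p\<close>.\<close>

lemma lat_conj:
  assumes "lat 0 0 1 0 g" "lat b a b b l"
  shows "lat b a b b (mmul eps (madj g) (mmul eps l g))"
proof -
  have "lat b a b b (mmul eps l g)"
    by (rule lat_mmul[OF assms(2,1)]) (use ab in auto)
  then show ?thesis
    by (rule lat_mmul[of 0 0 1 0, rotated]) (use ab assms(1) in auto)
qed

section \<open>The inducing subgroup in orbit coordinates\<close>

definition H :: "'a m2 set" where
  "H = {g \<in> Kgrp nu eps. vge nu b (cx g) \<and> vge nu a (cy g - 1)}"

text \<open>The third coordinate is controlled by the other two: by \<open>orb_det\<close>,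
  \<open>y * (t - w) = w * (1 - y) - eps * x^2\<close> with \<open>y\<close> a unit, and
  \<open>w\<close> supplies the extra power needed to pass from \<open>a\<close> to
  \<open>b\<close>.\<close>

lemma H_imp_lat:
  assumes "g \<in> H"
  shows "lat 0 0 1 0 g" "lat b a b b (msub (orb g) Xw)"
proof -
  have K: "g \<in> Kgrp nu eps" and x: "vge nu b (cx g)" and y: "vge nu a (cy g - 1)"
    using assms by (auto simp: H_def)
  note G = Kgrp_Ggrp[OF K]
  have "unit 1" by (simp add: unit_def)
  then have uy: "unit (cy g)" using vge_mono[OF y ab(1)] unit_congruent by blast
  have "cy g * (ct g - w) = w * (1 - cy g) - eps * cx g * cx g"
    using orb_det[OF G] by (simp add: algebra_simps)
  moreover have "vge nu b (w * (1 - cy g))"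
    by (rule vge_mult[OF w]) (use y vge_diff_commute ab in auto)
  moreover have "vge nu b (eps * cx g * cx g)"
    by (rule vge_mult[OF vge_mult[OF eps_vge x] x]) (use ab in auto)
  ultimately have t: "vge nu b (ct g - w)"
    using vge_unit_left[OF uy] vge_diff by metis
  then show "lat b a b b (msub (orb g) Xw)"
    using x y by (simp add: orb_form[OF G] Xw_def lat_def in_pE_def m_defs q_defs)
  have "vge nu 1 (ct g)"
    using vge_add[OF vge_mono[OF t ab(4)] w] by simp
  then show "lat 0 0 1 0 g" by (rule ct_maximal_ideal[OF K])
qed

lemma H_iff_lat: "g \<in> H \<longleftrightarrow> g \<in> Kgrp nu eps \<and> lat b a b b (msub (orb g) Xw)"
proof
  assume "g \<in> H"
  then show "g \<in> Kgrp nu eps \<and> lat b a b b (msub (orb g) Xw)"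
    using H_imp_lat by (simp add: H_def)
next
  assume "g \<in> Kgrp nu eps \<and> lat b a b b (msub (orb g) Xw)"
  then show "g \<in> H"
    by (simp add: H_def cx_def cy_def Xw_def lat_def in_pE_def m_defs q_defs)
qed

lemma H_subset_Kgrp: "h \<in> H \<Longrightarrow> h \<in> Kgrp nu eps"
  by (simp add: H_def)

lemma H_mid: "mid \<in> H"
  by (simp add: H_iff_lat)

text \<open>Telescoping: \<open>orb (g h) - Xw\<close> is the conjugate by \<open>h\<close> of
  \<open>orb g - Xw\<close>, plus \<open>orb h - Xw\<close>, and \<open>lat_conj\<close> handles the
  conjugate.\<close>

lemma H_mmul:
  assumes g: "g \<in> H" and h: "h \<in> H"
  shows "mmul eps g h \<in> H"
proof -
  have "msub (orb (mmul eps g h)) Xw =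
      madd (mmul eps (madj h) (mmul eps (msub (orb g) Xw) h)) (msub (orb h) Xw)"
    by (simp add: orb_mmul mmul_msub_left mmul_msub_right orb_def[of h] msub_chain)
  moreover have "lat b a b b \<dots>"
    by (intro lat_madd lat_conj H_imp_lat g h)
  ultimately show ?thesis using g h by (simp add: H_iff_lat)
qed

lemma H_madj:
  assumes g: "g \<in> H"
  shows "madj g \<in> H"
proof -
  have G: "g \<in> Ggrp eps" using g H_subset_Kgrp Kgrp_Ggrp by blast
  have "msub (orb (madj g)) Xw = mmul eps g (mmul eps (msub Xw (orb g)) (madj g))"
    by (simp add: orb_def mmul_msub_left mmul_msub_right mmul_assoc G)
  moreover have "lat b a b b (mmul eps (madj (madj g)) (mmul eps (msub Xw (orb g)) (madj g)))"
    using H_imp_lat[OF g] by (intro lat_conj) (auto intro: lat_msub_commute)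
  ultimately show ?thesis using g by (simp add: H_iff_lat)
qed

lemma J_near_mid:
  assumes "j \<in> Jgrp nu eps d"
  shows "lat 0 0 1 0 j" "j \<in> Ggrp eps" "j \<in> Kgrp nu eps"
proof -
  have "lat 0 a b 0 j"
    using assms ab by (intro lat_near_mid[of a _ _ a]) (auto simp: Jgrp_iff)
  then show l: "lat 0 0 1 0 j" by (rule lat_mono) (use ab in auto)
  show "j \<in> Ggrp eps" using assms by (simp add: Jgrp_iff)
  then show "j \<in> Kgrp nu eps" using l by (auto simp: Kgrp_iff intro: lat_mono)
qed

text \<open>\<open>orb j - Xw\<close> is \<open>madj j\<close> times the commutator of
  \<open>Xw\<close> with \<open>j\<close>. The identity drops out of the commutator, leaving
  \<open>j - mid\<close>, which is small.\<close>

lemma J_subset_H: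
  assumes j: "j \<in> Jgrp nu eps d"
  shows "j \<in> H"
proof -
  note G = J_near_mid(2)[OF j]
  have l: "lat a a b a (msub j mid)" using j by (simp add: Jgrp_iff)
  have "msub (orb j) Xw = mmul eps (madj j) (msub (mmul eps Xw j) (mmul eps j Xw))"
    by (simp add: orb_def mmul_msub_right G)
  also have "msub (mmul eps Xw j) (mmul eps j Xw) =
      msub (mmul eps Xw (msub j mid)) (mmul eps (msub j mid) Xw)"
    by (simp add: mmul_msub_left mmul_msub_right) (simp add: msub_def qsub_def)
  finally have eq: "msub (orb j) Xw = mmul eps (madj j)
      (msub (mmul eps Xw (msub j mid)) (mmul eps (msub j mid) Xw))" .
  have "lat b a b b (mmul eps Xw (msub j mid))" "lat b a b b (mmul eps (msub j mid) Xw)"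
    using ab by (auto intro!: lat_mmul[OF lat_Xw l] lat_mmul[OF l lat_Xw])
  from lat_msub[OF this] have "lat b a b b (msub (orb j) Xw)"
    unfolding eq by (rule lat_mmul[of 0 0 1 0, rotated]) (use J_near_mid[OF j] ab in auto)
  then show ?thesis using J_near_mid[OF j] by (simp add: H_iff_lat)
qed

lemma J_conj:
  assumes g: "g \<in> Kgrp nu eps" "lat 0 0 1 0 g" and j: "j \<in> Jgrp nu eps d"
  shows "mmul eps (mmul eps g j) (madj g) \<in> Jgrp nu eps d"
proof -
  note G = Kgrp_Ggrp[OF g(1)]
  have l: "lat a a b a (msub j mid)" using j by (simp add: Jgrp_iff)
  have "lat a a b a (mmul eps g (msub j mid))"
    by (rule lat_mmul[OF g(2) l]) (use ab in auto)
  then have "lat a a b a (mmul eps (mmul eps g (msub j mid)) (madj g))"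
    by (rule lat_mmul[of _ _ _ _ _ 0 0 1 0]) (use g ab in auto)
  with G j show ?thesis by (simp add: Jgrp_iff msub_conj)
qed

lemma Kfilt_subset_J:
  assumes "g \<in> Kfilt nu eps n" "b \<le> int n"
  shows "g \<in> Jgrp nu eps d"
  using assms ab by (auto simp: Kfilt_iff Jgrp_iff elim: lat_mono)

text \<open>The reduction of \<open>g\<close> to the centraliser replaces the first column of \<open>g\<close> so that the result
  \<open>M\<close> is a linear combination of \<open>1\<close> and \<^term>\<open>Xw\<close>. Unitarity of \<open>g\<close> makes \<open>M\<close> unitary up to the
  scalar \<^term>\<open>cy g\<close>, which is removed by Hensel's lemma.\<close>
lemma H_factor:
  assumes g: "g \<in> H"
  shows "\<exists>t j. t \<in> Kgrp nu eps \<and> mmul eps t Xw = mmul eps Xw t \<and> j \<in> Jgrp nu eps d \<and> g = mmul eps t j"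
proof -
  have K: "g \<in> Kgrp nu eps" and y: "vge nu a (cy g - 1)" using g by (auto simp: H_def)
  note G = Kgrp_Ggrp[OF K]
  have "unit 1" by (simp add: unit_def)
  then have uy: "unit (cy g)" using vge_mono[OF y ab(1)] unit_congruent by blast
  have "1 / cy g - 1 = (1 - cy g) / cy g" using unit_nonzero[OF uy] by (simp add: field_simps)
  then have "vge nu a (1 / cy g - 1)"
    using y vge_diff_commute vge_unit_divide[OF uy] by metis
  then obtain c where c: "c * c = 1 / cy g" "vge nu a (c - 1)"
    using hensel_sqrt[of a "1 / cy g - 1"] ab by auto
  define M where "M = M2 (m22 g) (m12 g) (qmul eps (QE w 0) (m12 g)) (m22 g)"
  define t where "t = msmul eps (QE c 0) M"
  \<comment> \<open>This entry says that the conjugate of \<open>m22 g\<close> times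
    \<open>m12 g\<close> has real part 0, which makes \<open>madj M * M\<close> scalar.\<close>
  have "m12 (mmul eps (madj g) g) = qzero" using G by (simp add: mid_def)
  then have iso: "re (m22 g) * re (m12 g) = eps * im (m22 g) * im (m12 g)"
    using two_nonzero by (simp add: m_defs q_defs) (simp add: algebra_simps flip: mult_2)
  have "mmul eps (madj M) M = msmul eps (QE (cy g) 0) mid"
    using iso by (simp add: M_def cy_eq qnorm_def m_defs q_defs algebra_simps)
  moreover have "madj t = msmul eps (QE c 0) (madj M)"
    by (simp add: t_def m_defs q_defs)
  ultimately have "mmul eps (madj t) t = msmul eps (QE (c * c * cy g) 0) mid"
    by (simp add: t_def msmul_mmul msmul_msmul) (simp add: q_defs mult.assoc)
  then have tG: "t \<in> Ggrp eps"
    using c unit_nonzero[OF uy] by (simp add: Ggrp_iff flip: qone_def)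
  have lg: "lat 0 0 1 0 g" using H_imp_lat[OF g] by simp
  then have lM: "lat 0 0 1 0 M"
    using w by (auto simp: M_def lat_def intro!: in_pE_qmul[of 1 _ 0]) (simp add: in_pE_def)
  \<comment> \<open>The \<open>(1,2)\<close> and \<open>(1,1)\<close> entries of this commutator are
    \<open>m11 g - m22 g\<close> and \<open>w * m12 g - m21 g\<close>, which compare the first
    columns of \<open>g\<close> and \<open>M\<close>.\<close>
  have comm: "msub (mmul eps g Xw) (mmul eps Xw g) = mmul eps g (msub Xw (orb g))"
    by (simp add: mmul_msub_right orb_def G)
  have "lat b a b b (mmul eps g (msub Xw (orb g)))"
    by (rule lat_mmul[OF lg lat_msub_commute[OF H_imp_lat(2)[OF g]]]) (use ab in auto)
  then have entries: "in_pE nu a (qsub (m11 g) (m22 g))" "in_pE nu b (qsub (qmul eps (QE w 0) (m12 g)) (m21 g))"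
    unfolding comm[symmetric] by (simp_all add: lat_def Xw_def in_pE_def m_defs q_defs algebra_simps)
  then have Mg: "lat a a b a (msub M g)"
    by (auto simp: M_def lat_def msub_def in_pE_def qsub_def vge_diff_commute)
  have tM: "lat a a b a (msub t M)"
  proof -
    have "msub t M = msmul eps (QE (c - 1) 0) M"
      by (simp add: t_def m_defs q_defs algebra_simps)
    moreover have "in_pE nu a (QE (c - 1) 0)" using c by (simp add: in_pE_def)
    ultimately show ?thesis
      using lM ab by (auto simp: lat_def msmul_def elim: in_pE_qmul)
  qed
  have tg: "lat a a b a (msub g t)"
    using lat_madd[OF tM Mg] by (simp add: msub_chain lat_msub_commute)
  have "in_pE nu 0 (QE c 0)"
    using vge_add[OF vge_mono[OF c(2), of 0], of 1] by (simp add: in_pE_def)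
  then have lt: "lat 0 0 1 0 t"
    using lM by (auto simp: t_def lat_def msmul_def elim: in_pE_qmul)
  have tK: "t \<in> Kgrp nu eps" using tG lt by (auto simp: Kgrp_iff intro: lat_mono)
  have tX: "mmul eps t Xw = mmul eps Xw t"
    by (simp add: t_def M_def Xw_def m_defs q_defs algebra_simps)
  define j where "j = mmul eps (madj t) g"
  have "msub j mid = mmul eps (madj t) (msub g t)"
    by (simp add: j_def mmul_msub_right tG)
  moreover have "lat a a b a (mmul eps (madj t) (msub g t))"
    by (rule lat_mmul[of 0 0 1 0, OF _ tg]) (use lt ab in auto)
  ultimately have "j \<in> Jgrp nu eps d"
    using tG G by (simp add: Jgrp_iff j_def)
  moreover have "g = mmul eps t j" by (simp add: j_def tG)
  ultimately show ?thesis using tK tX by blast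
qed

lemma centralizer_subset_H:
  assumes "t \<in> Kgrp nu eps" "mmul eps t Xw = mmul eps Xw t"
  shows "t \<in> H"
proof -
  have "orb t = Xw" using assms by (simp add: orb_def Kgrp_Ggrp flip: assms(2))
  then show ?thesis using assms(1) by (simp add: H_iff_lat)
qed

end

section \<open>Counting cosets\<close>

context nilpotent_orbit
begin

lemma low_Kgrp: "vge nu 0 c \<Longrightarrow> low c \<in> Kgrp nu eps"
  by (simp add: Kgrp_iff low_Ggrp) (simp add: low_def lat_def in_pE_def[of _ _ "QE _ _"])

lemma mw_Kgrp: "mw \<in> Kgrp nu eps"
  by (simp add: Kgrp_iff mw_Ggrp) (simp add: mw_def lat_def)

text \<open>Right translation by \<open>low c\<close> shifts \<open>x / y\<close> by
  \<open>c\<close> when \<open>y\<close> is a unit, so \<open>x\<close> can be normalised to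
  0.\<close>

lemma c_low:
  assumes "g \<in> Ggrp eps"
  shows "cx (mmul eps g (low c)) = cx g + c * cy g" "cy (mmul eps g (low c)) = cy g"
  using assms
  by (simp_all add: cx_def[of "mmul _ _ _"] cy_def[of "mmul _ _ _"] orb_mmul orb_form) (simp_all add: low_def m_defs q_defs)

lemma c_mw:
  assumes "g \<in> Ggrp eps"
  shows "cx (mmul eps g mw) = - cx g" "cy (mmul eps g mw) = ct g" "ct (mmul eps g mw) = cy g"
  using assms
  by (simp_all add: cx_def[of "mmul _ _ _"] cy_def[of "mmul _ _ _"] ct_def[of "mmul _ _ _"]
      orb_mmul orb_form) (simp_all add: mw_def m_defs q_defs)

text \<open>With \<open>x = 0\<close> and \<open>y\<close> a unit, \<open>y t = w\<close> puts
  \<open>t\<close> in \<open>p\<close>, so \<open>g\<close> is upper triangular modulo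
  \<open>p\<close>. Conjugation by \<open>g\<close> then preserves the lattice of \<open>H\<close>,
  and the question becomes whether \<open>orb g' - orb g\<close> lies in it.\<close>

lemma coset_iff_normalized:
  assumes g: "g \<in> Kgrp nu eps" "cx g = 0" "unit (cy g)" and g': "g' \<in> Kgrp nu eps"
  shows "mmul eps g' (madj g) \<in> H \<longleftrightarrow> vge nu a (cy g' - cy g) \<and> vge nu b (cx g')"
proof -
  note G = Kgrp_Ggrp[OF g(1)] and G' = Kgrp_Ggrp[OF g']
  have yt: "cy g * ct g = w" using orb_det[OF G] g(2) by simp
  then have "vge nu 1 (ct g)" using w vge_unit_left[OF g(3)] by metis
  then have lg: "lat 0 0 1 0 g" by (rule ct_maximal_ideal[OF g(1)])
  have fwd: "msub (orb (mmul eps g' (madj g))) Xw =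
      mmul eps (madj (madj g)) (mmul eps (msub (orb g') (orb g)) (madj g))"
    by (simp add: orb_mmul mmul_msub_left mmul_msub_right) (simp add: orb_def G mmul_assoc)
  have bwd: "msub (orb g') (orb g) =
      mmul eps (madj g) (mmul eps (msub (orb (mmul eps g' (madj g))) Xw) g)"
    by (simp add: orb_mmul mmul_msub_left mmul_msub_right orb_def[of g]) (simp add: G mmul_assoc)
  have diff: "msub (orb g') (orb g) = M2 (QE 0 (cx g')) (QE (cy g' - cy g) 0)
      (QE (ct g' - ct g) 0) (QE 0 (- cx g'))"
    by (simp add: orb_form[OF G] orb_form[OF G'] g(2) m_defs q_defs)
  show ?thesis
  proof
    assume "mmul eps g' (madj g) \<in> H"
    then have "lat b a b b (msub (orb g') (orb g))"
      unfolding bwd by (intro lat_conj lg H_imp_lat)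
    then show "vge nu a (cy g' - cy g) \<and> vge nu b (cx g')"
      unfolding diff by (simp add: lat_def in_pE_def)
  next
    assume *: "vge nu a (cy g' - cy g) \<and> vge nu b (cx g')"
    then have y: "vge nu a (cy g' - cy g)" and x: "vge nu b (cx g')" by auto
    have uy': "unit (cy g')" using unit_congruent[OF g(3)] vge_mono[OF y ab(1)] .
    \<comment> \<open>Multiplying by the two units brings in the determinant relations of
      \<open>g\<close> and \<open>g'\<close>, which bound the remaining coordinate.\<close>
    have "cy g * cy g' * (ct g' - ct g) =
        cy g * (cy g' * ct g') - cy g' * (cy g * ct g)"
      by (simp add: algebra_simps)
    also have "\<dots> = - (w * (cy g' - cy g) + cy g * (eps * cx g' * cx g'))"
      unfolding yt orb_det[OF G'] by (simp add: algebra_simps)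
    finally have eq: "cy g * cy g' * (ct g' - ct g) =
        - (w * (cy g' - cy g) + cy g * (eps * cx g' * cx g'))" .
    have "vge nu b (w * (cy g' - cy g))"
      by (rule vge_mult[OF w y]) (use ab in auto)
    moreover have "vge nu b (eps * cx g' * cx g')"
      by (rule vge_mult[OF vge_mult[OF eps_vge x] x]) (use ab in auto)
    then have "vge nu b (cy g * (eps * cx g' * cx g'))"
      using vge_unit_left[OF g(3)] by metis
    ultimately have "vge nu b (cy g * cy g' * (ct g' - ct g))"
      unfolding eq vge_uminus by (rule vge_add)
    then have "vge nu b (ct g' - ct g)"
      using vge_unit_left[OF unit_mult[OF g(3) uy']] by metis
    then have "lat b a b b (msub (orb g') (orb g))"
      unfolding diff using * by (simp add: lat_def in_pE_def)
    then have "lat b a b b (msub (orb (mmul eps g' (madj g))) Xw)"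
      unfolding fwd using lg by (intro lat_conj) auto
    then show "mmul eps g' (madj g) \<in> H" using g g' by (simp add: H_iff_lat)
  qed
qed

lemma coset_iff:
  assumes g: "g \<in> Kgrp nu eps" "unit (cy g)" and g': "g' \<in> Kgrp nu eps" "unit (cy g')"
  shows "mmul eps g' (madj g) \<in> H \<longleftrightarrow>
    vge nu a (cy g' - cy g) \<and> vge nu b (cx g' / cy g' - cx g / cy g)"
proof -
  note G = Kgrp_Ggrp[OF g(1)] and G' = Kgrp_Ggrp[OF g'(1)]
  \<comment> \<open>Chosen so that \<open>low c\<close> kills \<open>cx g\<close>. Translating both
    elements by it leaves \<open>g' * madj g\<close> unchanged.\<close>
  define c where "c = - (cx g / cy g)"
  have "vge nu 0 c" using c_vge[OF g(1)] vge_unit_divide[OF g(2)] by (simp add: c_def)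
  note n = low_Kgrp[OF this]
  have "mmul eps g' (madj g) = mmul eps (mmul eps g' (low c)) (madj (mmul eps g (low c)))"
    by (simp add: madj_mmul mmul_assoc low_Ggrp)
  also have "\<dots> \<in> H \<longleftrightarrow> vge nu a (cy g' - cy g) \<and> vge nu b (cx g' + c * cy g')"
    using coset_iff_normalized[of "mmul eps g (low c)" "mmul eps g' (low c)"]
      g g' n unit_nonzero[OF g(2)] by (simp add: c_low G G' c_def)
  also have "cx g' + c * cy g' = cy g' * (cx g' / cy g' - cx g / cy g)"
    using unit_nonzero[OF g'(2)] by (simp add: c_def field_simps)
  finally show ?thesis by (simp add: vge_unit_left[OF g'(2)])
qed

text \<open>\<open>orb h\<close> is congruent to \<open>Xw\<close> modulo \<open>p\<close> for
  \<open>h\<close> in \<open>H\<close>, and conjugation by \<open>g\<close> in \<open>K\<close>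
  preserves matrices over \<open>p\<close>, so \<open>orb g'\<close> and \<open>orb g\<close> agree
  modulo \<open>p\<close>.\<close>

lemma H_preserves_unit:
  assumes g: "g \<in> Kgrp nu eps" and h: "mmul eps g' (madj g) \<in> H" and u: "unit (cy g)"
  shows "unit (cy g')"
proof -
  note G = Kgrp_Ggrp[OF g]
  let ?h = "mmul eps g' (madj g)"
  have eq: "msub (orb g') (orb g) = mmul eps (madj g) (mmul eps (msub (orb ?h) Xw) g)"
    by (simp add: orb_mmul mmul_msub_left mmul_msub_right orb_def[of g]) (simp add: G mmul_assoc)
  have lg: "lat 0 0 0 0 g" using g by (simp add: Kgrp_iff)
  have "lat 1 1 1 1 (msub (orb ?h) Xw)"
    using H_imp_lat(2)[OF h] by (rule lat_mono) (use ab in auto)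
  then have "lat 1 1 1 1 (mmul eps (msub (orb ?h) Xw) g)"
    by (rule lat_mmul[OF _ lg]) auto
  then have "lat 1 1 1 1 (msub (orb g') (orb g))"
    unfolding eq by (rule lat_mmul[of 0 0 0 0, rotated]) (use lg in auto)
  then have "vge nu 1 (cy g' - cy g)"
    by (simp add: lat_def in_pE_def cy_def msub_def qsub_def)
  then show ?thesis using unit_congruent u by blast
qed

lemma cy_or_ct_unit:
  assumes g: "g \<in> Kgrp nu eps" and y: "\<not> unit (cy g)"
  shows "unit (ct g)" "vge nu 1 (cx g)"
proof -
  note G = Kgrp_Ggrp[OF g] and c = c_vge[OF g]
  have y1: "vge nu 1 (cy g)" using y c by (simp add: unit_iff)
  have "vge nu 1 (cy (mmul eps (mmul eps g mw) mw))"
    using y1 by (simp add: c_mw G mw_Ggrp)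
  \<comment> \<open>The lower left entry of \<open>g mw\<close> is \<open>m22 g\<close>, and its
    \<open>ct\<close> is \<open>cy g\<close>.\<close>
  then have "lat 0 0 1 0 (mmul eps g mw)"
    using y1 g mw_Kgrp G by (intro ct_maximal_ideal) (simp_all add: c_mw)
  then have d: "in_pE nu 1 (m22 g)"
    by (simp add: lat_def mw_def m_defs q_defs)
  show "unit (ct g)"
  proof (rule ccontr)
    assume "\<not> unit (ct g)"
    then have "lat 0 0 1 0 g" using c by (intro ct_maximal_ideal[OF g]) (simp add: unit_iff)
    with d have l: "lat 0 0 1 1 g" by (simp add: lat_def)
    \<comment> \<open>With the second row of \<open>g\<close> in \<open>p\<close>, the lower right
      entry of the identity would lie in \<open>p\<close>.\<close>
    have "lat 0 0 0 1 (mmul eps (madj g) g)"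
      by (rule lat_mmul[of 1 0 1 0]) (use l in auto)
    then show False using G by (simp add: lat_def mid_def)
  qed
  have "vge nu 1 (cy g * ct g)" by (rule vge_mult[OF y1 c(3)]) simp
  then have "vge nu 1 (eps * (cx g * cx g))"
    using w vge_diff[of 1 w "cy g * ct g"] orb_det[OF G] by (simp add: mult.assoc)
  then show "vge nu 1 (cx g)"
    using vge_unit_left[OF eps_unit] vge_ideal_prime c(1) by metis
qed

text \<open>A complete invariant of the coset \<open>H g\<close>, in two charts. When
  \<open>y\<close> is not a unit, \<open>t\<close> is one, and the data recorded are those of
  \<open>g mw\<close> in the first chart, in view of \<open>c_mw\<close>.\<close>

definition cls :: "'a m2 \<Rightarrow> bool \<times> 'a set \<times> 'a set" where
  "cls g = (if unit (cy g) then (True, res a (cy g), res b (cx g / cy g))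
     else (False, res a (ct g), res b (- cx g / ct g)))"

lemma cls_eq_iff:
  assumes g: "g \<in> Kgrp nu eps" and g': "g' \<in> Kgrp nu eps"
  shows "cls g' = cls g \<longleftrightarrow> mmul eps g' (madj g) \<in> H"
proof -
  note G = Kgrp_Ggrp[OF g] and G' = Kgrp_Ggrp[OF g']
  have sym: "mmul eps g (madj g') \<in> H \<longleftrightarrow> mmul eps g' (madj g) \<in> H"
    using H_madj by (metis madj_madj madj_mmul)
  consider "unit (cy g)" "unit (cy g')" | "unit (cy g)" "\<not> unit (cy g')"
    | "\<not> unit (cy g)" "unit (cy g')" | "\<not> unit (cy g)" "\<not> unit (cy g')" by blast
  then show ?thesis
  proof cases
    case 1
    then show ?thesis using coset_iff[OF g 1(1) g' 1(2)] by (simp add: cls_def res_eq_iff)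
  next
    case 2
    then show ?thesis using H_preserves_unit[OF g] by (auto simp: cls_def)
  next
    case 3
    then show ?thesis using H_preserves_unit[OF g'] sym by (auto simp: cls_def)
  next
    case 4
    have eq: "mmul eps g' (madj g) = mmul eps (mmul eps g' mw) (madj (mmul eps g mw))"
      by (simp add: madj_mmul mmul_assoc mw_Ggrp)
    show ?thesis
      using coset_iff[of "mmul eps g mw" "mmul eps g' mw"] 4 g g' mw_Kgrp cy_or_ct_unit
      by (simp add: eq cls_def res_eq_iff c_mw G G')
  qed
qed

lemma ex_with_coordinates:
  assumes y: "unit y" and c: "vge nu 0 c"
  shows "\<exists>g. g \<in> Kgrp nu eps \<and> cy g = y \<and> cx g = c * y"
proof -
  obtain l where l: "in_pE nu 0 l" "qnorm eps l = y" using qnorm_surj[OF y] by blast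
  \<comment> \<open>This is \<open>l / y\<close>, the inverse of the conjugate of \<open>l\<close>,
    as needed for the diagonal matrix \<open>D\<close> to be unitary.\<close>
  define \<mu> where "\<mu> = QE (re l / y) (im l / y)"
  define D where "D = M2 \<mu> qzero qzero l"
  have y0: "y \<noteq> 0" using unit_nonzero[OF y] .
  have n: "re l * re l - eps * im l * im l = y" using l(2) by (simp add: qnorm_def)
  have G: "D \<in> Ggrp eps"
    using y0 n by (simp add: Ggrp_iff D_def \<mu>_def m_defs q_defs qe.expand divide_simps)
  have K: "D \<in> Kgrp nu eps"
    using G l(1) by (simp add: Kgrp_iff lat_def D_def \<mu>_def in_pE_def qzero_def vge_unit_divide[OF y])
  have D: "cy D = y" "cx D = 0"
    using l(2) by (simp_all add: cy_eq) (simp_all add: D_def cx_def orb_def Xw_def qnorm_def m_defs q_defs)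
  show ?thesis
    by (rule exI[of _ "mmul eps D (low c)"]) (simp add: K low_Kgrp c c_low G D)
qed

lemma cls_image:
  "cls ` Kgrp nu eps =
    {True} \<times> (res a ` {y. unit y}) \<times> (res b ` O\<^sub>F) \<union>
    {False} \<times> (res a ` {y. unit y}) \<times> (res b ` {x. vge nu 1 x})" (is "_ = ?R")
proof
  show "cls ` Kgrp nu eps \<subseteq> ?R"
  proof (rule image_subsetI)
    fix g assume g: "g \<in> Kgrp nu eps"
    show "cls g \<in> ?R"
    proof (cases "unit (cy g)")
      case True
      then show ?thesis using c_vge[OF g] by (simp add: cls_def vge_unit_divide)
    next
      case False
      then show ?thesis using cy_or_ct_unit[OF g False] by (simp add: cls_def vge_unit_divide)
    qed
  qed
  have "(True, res a y, res b c) \<in> cls ` Kgrp nu eps" if yc: "unit y" "vge nu 0 c" for y c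
  proof -
    obtain g where "g \<in> Kgrp nu eps" "cy g = y" "cx g = c * y"
      using ex_with_coordinates[OF yc] by blast
    then show ?thesis
      using yc(1) unit_nonzero by (intro image_eqI[of _ _ g]) (auto simp: cls_def)
  qed
  moreover have "(False, res a y, res b c) \<in> cls ` Kgrp nu eps" if yc: "unit y" "vge nu 1 c" for y c
  proof -
    obtain g where g: "g \<in> Kgrp nu eps" "cy g = y" "cx g = c * y"
      using ex_with_coordinates[OF yc(1) vge_mono[OF yc(2)]] by auto
    note G = Kgrp_Ggrp[OF g(1)]
    \<comment> \<open>Having \<open>x\<close> in \<open>p\<close> forces \<open>y t\<close>, hence
      \<open>t\<close>, into \<open>p\<close>; so \<open>g mw\<close> falls in the second
      chart.\<close>
    have "vge nu 1 (eps * cx g * cx g)"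
    proof -
      have "vge nu 1 (cx g)"
        unfolding g by (rule vge_mult[OF yc(2) unit_vge[OF yc(1)]]) simp
      then show ?thesis by (intro vge_mult[OF vge_mult[OF eps_vge]]) auto
    qed
    then have "vge nu 1 (cy g * ct g)" unfolding orb_det[OF G] by (intro vge_diff w)
    then have "vge nu 1 (ct g)" using g(2) yc(1) vge_unit_left by metis
    then have "\<not> unit (cy (mmul eps g mw))" by (simp add: c_mw G unit_iff)
    then show ?thesis
      using yc(1) g unit_nonzero mw_Kgrp
      by (intro image_eqI[of _ _ "mmul eps g mw"]) (auto simp: cls_def c_mw G)
  qed
  ultimately show "?R \<subseteq> cls ` Kgrp nu eps" by auto
qed

text \<open>The two charts together give \<open>(q^a - q^(a-1)) * (q^b + q^(b-1))\<close>, where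
  \<open>a + b = d + 1\<close>.\<close>

lemma card_cls: "finite (cls ` Kgrp nu eps)" "card (cls ` Kgrp nu eps) = q ^ (d - 1) * (q\<^sup>2 - 1)"
proof -
  obtain m n where mn: "(d + 1) div 2 = Suc m" "(d + 2) div 2 = Suc n" "m + n = d - 1"
  proof
    show "(d + 1) div 2 = Suc ((d + 1) div 2 - 1)" "(d + 2) div 2 = Suc ((d + 2) div 2 - 1)"
      "((d + 1) div 2 - 1) + ((d + 2) div 2 - 1) = d - 1"
      using d by auto
  qed
  note fin = card_res(1)[of "Suc n"] card_res_units(1)[of m] card_res_maximal_ideal(1)[of n]
  show "finite (cls ` Kgrp nu eps)"
    unfolding cls_image mn using fin by simp
  have "card (cls ` Kgrp nu eps) = (q ^ Suc m - q ^ m) * q ^ Suc n + (q ^ Suc m - q ^ m) * q ^ n"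
    unfolding cls_image mn using fin
    by (subst card_Un_disjoint)
      (auto simp: card_cartesian_product card_res(2) card_res_units(2) card_res_maximal_ideal(2)
        simp del: power_Suc of_nat_Suc)
  also have "\<dots> = q ^ (m + n) * (q\<^sup>2 - 1)"
    by (cases q) (simp_all add: power_add power2_eq_square algebra_simps)
  finally show "card (cls ` Kgrp nu eps) = q ^ (d - 1) * (q\<^sup>2 - 1)" by (simp add: mn)
qed

end

section \<open>Induced representations of finite index\<close>

interpretation cs: vector_space "cscale :: complex \<Rightarrow> ('b \<Rightarrow> complex) \<Rightarrow> ('b \<Rightarrow> complex)"
  by unfold_locales (auto simp: cscale_def fun_eq_iff algebra_simps)

lemma sum_fun_eval: "(\<Sum>r\<in>R. f r) x = (\<Sum>r\<in>R. f r x)" for f :: "'c \<Rightarrow> 'b \<Rightarrow> complex"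
  by (induction R rule: infinite_finite_induct) auto

text \<open>\<open>iv\<close> is inversion and \<open>cls\<close> labels the cosets
  \<open>H g\<close>; finiteness of its image says that \<open>H\<close> has finite index.\<close>

locale induced_representation =
  fixes eps :: "'a::field" and K H :: "'a m2 set" and chi :: "'a m2 \<Rightarrow> complex"
    and iv :: "'a m2 \<Rightarrow> 'a m2" and cls :: "'a m2 \<Rightarrow> 'c"
  assumes K_mid: "mid \<in> K"
    and K_mmul: "g \<in> K \<Longrightarrow> h \<in> K \<Longrightarrow> mmul eps g h \<in> K"
    and K_iv: "g \<in> K \<Longrightarrow> iv g \<in> K"
    and iv_right: "g \<in> K \<Longrightarrow> mmul eps g (iv g) = mid"
    and iv_left: "g \<in> K \<Longrightarrow> mmul eps (iv g) g = mid"
    and H_subset: "h \<in> H \<Longrightarrow> h \<in> K"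
    and H_mid: "mid \<in> H"
    and H_mmul: "g \<in> H \<Longrightarrow> h \<in> H \<Longrightarrow> mmul eps g h \<in> H"
    and H_iv: "g \<in> H \<Longrightarrow> iv g \<in> H"
    and character: "is_character eps H chi"
    and cls_iff: "g \<in> K \<Longrightarrow> g' \<in> K \<Longrightarrow> cls g' = cls g \<longleftrightarrow> mmul eps g' (iv g) \<in> H"
    and finite_cls: "finite (cls ` K)"
begin

definition V where "V = ind_space eps K H chi"

lemma chi_mmul: "g \<in> H \<Longrightarrow> h \<in> H \<Longrightarrow> chi (mmul eps g h) = chi g * chi h"
  using character by (simp add: is_character_def)

lemma chi_nonzero: "h \<in> H \<Longrightarrow> chi h \<noteq> 0"
  using character by (simp add: is_character_def)

lemma chi_mid: "chi mid = 1"
  using chi_mmul[OF H_mid H_mid] chi_nonzero[OF H_mid] by simp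

lemma iv_cancel: "g \<in> K \<Longrightarrow> mmul eps (iv g) (mmul eps g A) = A"
  "g \<in> K \<Longrightarrow> mmul eps g (mmul eps (iv g) A) = A"
  by (simp_all add: iv_left iv_right flip: mmul_assoc)

lemma V_outside: "f \<in> V \<Longrightarrow> k \<notin> K \<Longrightarrow> f k = 0"
  by (simp add: V_def ind_space_def)

lemma V_mmul: "f \<in> V \<Longrightarrow> h \<in> H \<Longrightarrow> k \<in> K \<Longrightarrow> f (mmul eps h k) = chi h * f k"
  by (simp add: V_def ind_space_def)

lemma V_cls:
  assumes f: "f \<in> V" and k: "k \<in> K" "g \<in> K" "cls k = cls g"
  shows "f k = chi (mmul eps k (iv g)) * f g"
proof -
  have "mmul eps k (iv g) \<in> H" using cls_iff[of g k] k by simp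
  from V_mmul[OF f this k(2)] show ?thesis by (simp add: mmul_assoc iv_left k)
qed

lemma V_cls_nonzero: "f \<in> V \<Longrightarrow> k \<in> K \<Longrightarrow> g \<in> K \<Longrightarrow> cls k = cls g \<Longrightarrow> f k \<noteq> 0 \<longleftrightarrow> f g \<noteq> 0"
  using V_cls[of f k g] cls_iff[of g k] chi_nonzero by simp

lemma mmul_H_iff:
  assumes "h \<in> H" "g \<in> K"
  shows "mmul eps h g \<in> H \<longleftrightarrow> g \<in> H"
  using assms H_mmul H_iv H_subset iv_cancel(1) by metis

lemma K_mmul_iff:
  assumes "k \<in> K"
  shows "mmul eps x k \<in> K \<longleftrightarrow> x \<in> K"
  using assms K_mmul K_iv iv_right mmul_assoc mmul_mid(1) by metis

text \<open>The function of the induced space supported on the coset \<open>H g\<close> with value 1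
  at \<open>g\<close>.\<close>

definition delta :: "'a m2 \<Rightarrow> 'a m2 \<Rightarrow> complex" where
  "delta g k = (if k \<in> K \<and> mmul eps k (iv g) \<in> H then chi (mmul eps k (iv g)) else 0)"

lemma delta_in_V:
  assumes g: "g \<in> K"
  shows "delta g \<in> V"
  using g by (auto simp: V_def ind_space_def delta_def mmul_assoc mmul_H_iff chi_mmul
      K_mmul K_iv H_subset)

lemma delta_translate: "g \<in> K \<Longrightarrow> delta g = ract eps (iv g) (delta mid)"
  using iv_left[OF K_mid] by (auto simp: fun_eq_iff delta_def ract_def K_mmul_iff K_iv)

lemma transversal:
  obtains R where "R \<subseteq> K" "finite R" "card R = card (cls ` K)"
    "\<And>r s. r \<in> R \<Longrightarrow> s \<in> R \<Longrightarrow> delta r s = (if r = s then 1 else 0)"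
    "\<And>f. f \<in> V \<Longrightarrow> f = (\<Sum>r\<in>R. cscale (f r) (delta r))"
proof -
  obtain R where R: "R \<subseteq> K" "inj_on cls R" "cls ` K = cls ` R"
    using ex_transversal by (metis (lifting))
  have fR: "finite R" "card R = card (cls ` K)"
    using R finite_cls by (metis finite_image_iff, metis card_image)
  have delta_R: "delta r k = (if cls k = cls r then chi (mmul eps k (iv r)) else 0)"
    if "r \<in> R" "k \<in> K" for r k
    using that R(1) cls_iff[of r k] by (auto simp: delta_def)
  show thesis
  proof
    show "R \<subseteq> K" "finite R" "card R = card (cls ` K)" by fact+
    show "delta r s = (if r = s then 1 else 0)" if "r \<in> R" "s \<in> R" for r s
    proof -
      have "s \<in> K" "cls s = cls r \<longleftrightarrow> r = s" using that R by (auto simp: inj_on_def)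
      then show ?thesis using delta_R[OF that(1), of s] iv_right chi_mid by simp
    qed
    fix f assume f: "f \<in> V"
    show "f = (\<Sum>r\<in>R. cscale (f r) (delta r))"
    proof
      fix k
      show "f k = (\<Sum>r\<in>R. cscale (f r) (delta r)) k"
      proof (cases "k \<in> K")
        case False
        then show ?thesis by (simp add: sum_fun_eval cscale_def delta_def V_outside[OF f])
      next
        case True
        then obtain s where s: "s \<in> R" "cls k = cls s" using R(3) by blast
        have "(\<Sum>r\<in>R. cscale (f r) (delta r)) k =
            (\<Sum>r\<in>R. if r = s then f s * chi (mmul eps k (iv s)) else 0)"
          unfolding sum_fun_eval
        proof (rule sum.cong)
          fix r assume "r \<in> R"
          moreover have "cls k = cls r \<longleftrightarrow> r = s"
            using s \<open>r \<in> R\<close> R(2) by (auto simp: inj_on_def)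
          ultimately show "cscale (f r) (delta r) k =
              (if r = s then f s * chi (mmul eps k (iv s)) else 0)"
            using delta_R[of r k] True by (simp add: cscale_def)
        qed simp
        also have "\<dots> = f k"
          using V_cls[OF f True _ s(2)] s(1) R(1) fR(1) by auto
        finally show ?thesis by simp
      qed
    qed
  qed
qed

text \<open>The functions \<open>delta r\<close> for \<open>r\<close> in a transversal are dual to
  evaluation at its points, hence form a basis.\<close>

lemma degree: "rep_degree V = card (cls ` K)"
proof -
  obtain R where R: "R \<subseteq> K" "finite R" "card R = card (cls ` K)"
    and delta_R: "\<And>r s. r \<in> R \<Longrightarrow> s \<in> R \<Longrightarrow> delta r s = (if r = s then 1 else 0)"
    and expand: "\<And>f. f \<in> V \<Longrightarrow> f = (\<Sum>r\<in>R. cscale (f r) (delta r))"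
    by (rule transversal) blast
  have inj: "inj_on delta R"
  proof (rule inj_onI)
    fix r s assume "r \<in> R" "s \<in> R" "delta r = delta s"
    then show "r = s" using delta_R[of r s] delta_R[of s s] by (metis zero_neq_one)
  qed
  show ?thesis
    unfolding rep_degree_def
  proof (rule cs.dim_unique)
    show "delta ` R \<subseteq> V" using R(1) delta_in_V by blast
    show "V \<subseteq> cs.span (delta ` R)"
    proof
      fix f assume "f \<in> V"
      have "(\<Sum>r\<in>R. cscale (f r) (delta r)) \<in> cs.span (delta ` R)"
        by (intro cs.span_sum cs.span_scale cs.span_base imageI)
      then show "f \<in> cs.span (delta ` R)" using expand[OF \<open>f \<in> V\<close>] by simp
    qed
    show "cs.independent (delta ` R)"
    proof (rule cs.independent_if_scalars_zero)
      show "finite (delta ` R)" using R by simp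
      fix c x assume sum0: "(\<Sum>x\<in>delta ` R. cscale (c x) x) = 0" and "x \<in> delta ` R"
      then obtain s where s: "s \<in> R" "x = delta s" by blast
      have "0 = (\<Sum>r\<in>R. cscale (c (delta r)) (delta r)) s"
        using sum0 by (simp add: sum.reindex[OF inj])
      also have "\<dots> = (\<Sum>r\<in>R. if r = s then c (delta r) else 0)"
        unfolding sum_fun_eval by (rule sum.cong) (use delta_R s in \<open>auto simp: cscale_def\<close>)
      also have "\<dots> = c x" using s R(2) by simp
      finally show "c x = 0" by simp
    qed
    show "card (delta ` R) = card (cls ` K)" using R(3) inj by (simp add: card_image)
  qed
qed

lemma delta_mid_nonzero: "delta mid mid = 1"
  using iv_right[OF K_mid] by (simp add: delta_def K_mid H_mid chi_mid)

text \<open>A vector of minimal support cannot lose a coset by subtracting a multiple of itself from a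
  translate whose support is no larger.\<close>
lemma ex_minimal_support:
  assumes W: "cs.subspace W" "W \<subseteq> V" "\<forall>k\<in>K. \<forall>f\<in>W. ract eps k f \<in> W"
    and f0: "f0 \<in> W" "f0 mid \<noteq> 0"
  obtains f where "f \<in> W" "f mid \<noteq> 0"
    "\<And>n k. n \<in> K \<Longrightarrow> (\<And>g. g \<in> K \<Longrightarrow> f g = 0 \<Longrightarrow> f (mmul eps g n) = 0) \<Longrightarrow>
       k \<in> K \<Longrightarrow> f k \<noteq> 0 \<Longrightarrow> f (mmul eps k n) * f mid = f n * f k"
proof -
  \<comment> \<open>Supports are measured in cosets, so that they are finite and can be compared by
    cardinality.\<close>
  define supp where "supp f = cls ` {k \<in> K. f k \<noteq> 0}" for f :: "'a m2 \<Rightarrow> complex"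
  define m where "m f = card (supp f)" for f
  obtain f where f: "f \<in> W" "f mid \<noteq> 0" and min: "\<And>g. g \<in> W \<Longrightarrow> g mid \<noteq> 0 \<Longrightarrow> m f \<le> m g"
    using ex_has_least_nat[of "\<lambda>f. f \<in> W \<and> f mid \<noteq> 0" f0 m] f0 by blast
  have fV: "f \<in> V" using f W by blast
  show thesis
  proof
    show "f \<in> W" "f mid \<noteq> 0" by fact+
    fix n k assume n: "n \<in> K" "\<And>g. g \<in> K \<Longrightarrow> f g = 0 \<Longrightarrow> f (mmul eps g n) = 0"
      and k: "k \<in> K" "f k \<noteq> 0"
    show "f (mmul eps k n) * f mid = f n * f k"
    proof (rule ccontr)
      assume ne: "f (mmul eps k n) * f mid \<noteq> f n * f k"
      \<comment> \<open>With this factor \<open>f'\<close> vanishes at \<open>k\<close>, while the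
        negated identity is exactly what keeps \<open>f' mid\<close> nonzero.\<close>
      define c where "c = f (mmul eps k n) / f k"
      define f' where "f' = ract eps n f + cscale (- c) f"
      have f': "f' x = f (mmul eps x n) - c * f x" for x
        by (simp add: f'_def ract_def cscale_def)
      have "f' \<in> W" unfolding f'_def
        by (intro cs.subspace_add[OF W(1)] cs.subspace_scale[OF W(1)] f) (use W f n in blast)
      then have f'V: "f' \<in> V" using W by blast
      have "f' mid \<noteq> 0" using ne k by (simp add: f' c_def field_simps)
      then have "m f \<le> m f'" by (rule min[OF \<open>f' \<in> W\<close>])
      moreover have "supp f' \<subset> supp f"
      proof
        show "supp f' \<subseteq> supp f" using n(2) by (auto simp: supp_def f')
        have "f' k = 0" using k by (simp add: f' c_def)
        then have "cls k \<notin> supp f'"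
          using V_cls_nonzero[OF f'V k(1)] by (auto simp: supp_def)
        moreover have "cls k \<in> supp f" using k by (auto simp: supp_def)
        ultimately show "supp f' \<noteq> supp f" by blast
      qed
      moreover have "finite (supp f)"
        unfolding supp_def by (rule finite_subset[OF _ finite_cls]) auto
      ultimately show False
        using psubset_card_mono[of "supp f" "supp f'"] by (simp add: m_def)
    qed
  qed
qed

text \<open>A function of the space supported on \<open>H\<close> and nonzero at \<open>mid\<close>
  is a multiple of \<open>delta mid\<close>, whose translates span \<open>V\<close>. Nonvanishing at
  \<open>mid\<close> can be arranged by translation.\<close>

lemma irreducible:
  assumes "\<And>W f. cs.subspace W \<Longrightarrow> W \<subseteq> V \<Longrightarrow> \<forall>k\<in>K. \<forall>f\<in>W. ract eps k f \<in> W \<Longrightarrow>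
      f \<in> W \<Longrightarrow> f mid \<noteq> 0 \<Longrightarrow> \<exists>f\<in>W. f mid \<noteq> 0 \<and> (\<forall>k\<in>K. f k \<noteq> 0 \<longrightarrow> k \<in> H)"
  shows "irreducible_rep eps K V"
  unfolding irreducible_rep_def
proof (intro conjI allI impI)
  show "V \<noteq> {0}"
    using delta_in_V[OF K_mid] delta_mid_nonzero by (metis singletonD zero_fun_apply zero_neq_one)
  fix W assume "cs.subspace W \<and> W \<subseteq> V \<and> (\<forall>k\<in>K. \<forall>f\<in>W. ract eps k f \<in> W)"
  then have W: "cs.subspace W" "W \<subseteq> V" "\<forall>k\<in>K. \<forall>f\<in>W. ract eps k f \<in> W" by auto
  show "W = {0} \<or> W = V"
  proof (cases "W \<subseteq> {0}")
    case True
    then show ?thesis using cs.subspace_0[OF W(1)] by blast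
  next
    case False
    then obtain f where "f \<in> W" "f \<noteq> 0" by blast
    then obtain k where k: "f k \<noteq> 0" by (auto simp: fun_eq_iff)
    then have "k \<in> K" using V_outside W \<open>f \<in> W\<close> by blast
    moreover have "ract eps k f mid \<noteq> 0" using k by (simp add: ract_def)
    ultimately obtain f' where f': "f' \<in> W" "f' mid \<noteq> 0" "\<forall>k\<in>K. f' k \<noteq> 0 \<longrightarrow> k \<in> H"
      using assms[OF W] W(3) \<open>f \<in> W\<close> by blast
    have f'V: "f' \<in> V" using f' W by blast
    have ivm: "iv mid = mid" using iv_left[OF K_mid] by simp
    have "delta mid = cscale (1 / f' mid) f'"
    proof
      fix k
      show "delta mid k = cscale (1 / f' mid) f' k"
      proof (cases "k \<in> H")
        case True
        then show ?thesis
          using V_mmul[OF f'V True K_mid] f'(2) by (simp add: delta_def ivm cscale_def H_subset)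
      next
        case False
        then have "f' k = 0" using f'(3) V_outside[OF f'V] by blast
        with False show ?thesis by (simp add: delta_def ivm cscale_def)
      qed
    qed
    then have "delta mid \<in> W" using cs.subspace_scale[OF W(1) f'(1)] by simp
    then have delta_W: "delta r \<in> W" if "r \<in> K" for r
      using that W(3) K_iv by (simp add: delta_translate)
    obtain R where "R \<subseteq> K" "\<And>f. f \<in> V \<Longrightarrow> f = (\<Sum>r\<in>R. cscale (f r) (delta r))"
      by (rule transversal) blast
    moreover have "(\<Sum>r\<in>R. cscale (f r) (delta r)) \<in> W" if "R \<subseteq> K" for f R
      using that delta_W by (intro cs.subspace_sum[OF W(1)] cs.subspace_scale[OF W(1)]) blast
    ultimately have "V \<subseteq> W" by (metis subsetI)
    then show ?thesis using W by blast
  qed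
qed

end

section \<open>Intertwining and the main theorem\<close>

locale regular_nilpotent_datum = nilpotent_orbit +
  fixes psi' :: "'a \<Rightarrow> complex" and z u v :: 'a and X :: "'a m2"
  assumes psi_add: "psi' (x + y) = psi' x * psi' y"
    and psi_triv: "vge nu 1 x \<Longrightarrow> psi' x = 1"
    and psi_nontriv: "\<exists>x. vge nu 0 x \<and> psi' x \<noteq> 1"
    and z: "vge nu (- int d) z"
    and u: "u \<noteq> 0" "nu u = - int d"
    and v: "v = u * w"
    and X: "X = M2 (QE 0 z) (QE 0 u) (QE 0 v) (QE 0 z)"
begin

abbreviation "\<Psi> \<equiv> PsiX eps psi' X"

lemma psi_zero [simp]: "psi' 0 = 1"
  by (rule psi_triv) simp

section \<open>Reading orbit coordinates from the character\<close>

lemma psi_diff_eq_1: "psi' x = psi' y \<Longrightarrow> psi' (x - y) = 1"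
  using psi_add[of x "- y"] psi_add[of y "- y"] by simp

text \<open>The annihilator of \<open>p^n\<close> under \<open>psi' (x * y)\<close> is
  \<open>p^(1-n)\<close>: otherwise \<open>e * p^n\<close> would contain all integers, on which
  \<open>psi'\<close> is nontrivial.\<close>

lemma psi_detect:
  assumes "\<And>c. vge nu n c \<Longrightarrow> psi' (e * c) = 1"
  shows "vge nu (1 - n) e"
proof (rule ccontr)
  assume "\<not> vge nu (1 - n) e"
  then have e: "e \<noteq> 0" "nu e \<le> - n" by (auto simp: vge_def)
  obtain x where x: "vge nu 0 x" "psi' x \<noteq> 1" using psi_nontriv by blast
  then have "vge nu n (x / e)" using e by (auto simp: vge_divide intro: vge_mono)
  with assms[of "x / e"] e x show False by simp
qed

lemma eps_u: "eps * u \<noteq> 0" "nu (eps * u) = - int d"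
  using eps_unit u by (simp_all add: unit_def nu_mult)

lemma psi_detect_scaled:
  assumes "\<And>c. vge nu n c \<Longrightarrow> psi' (eps * u * e * c) = 1"
  shows "vge nu (int d + 1 - n) e"
  using psi_detect[of n "eps * u * e"] assms vge_cancel_left[OF eps_u(1), of "1 - n" e]
  by (simp add: eps_u(2) algebra_simps)

lemma X_eq: "X = madd (msmul eps (QE 0 z) mid) (msmul eps (QE 0 u) Xw)"
  by (simp add: X Xw_def v m_defs q_defs)

lemma conj_X:
  assumes g: "g \<in> Ggrp eps"
  shows "mmul eps (madj g) (mmul eps X g) =
    M2 (QE (eps * u * cx g) z) (QE 0 (u * cy g)) (QE 0 (u * ct g)) (QE (- (eps * u * cx g)) z)"
proof -
  have "mmul eps (madj g) (mmul eps X g) = madd (msmul eps (QE 0 z) mid) (msmul eps (QE 0 u) (orb g))"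
    by (simp add: X_eq mmul_madd_left mmul_madd_right msmul_mmul g flip: orb_def)
  then show ?thesis
    by (simp add: orb_form[OF g] m_defs q_defs algebra_simps)
qed

text \<open>Each family of test elements isolates one coordinate: \<open>low\<close> detects
  \<open>y\<close>, \<open>upp\<close> detects \<open>t\<close> and \<open>dg\<close> detects
  \<open>x\<close>.\<close>

lemma Psi_low:
  assumes g: "g \<in> Ggrp eps"
  shows "\<Psi> (mmul eps (mmul eps g (low c)) (madj g)) = psi' (eps * u * cy g * c)"
  unfolding PsiX_conj[OF g] conj_X[OF g]
  by (simp add: low_def m_defs q_defs algebra_simps)

lemma Psi_upp:
  assumes g: "g \<in> Ggrp eps"
  shows "\<Psi> (mmul eps (mmul eps g (upp c)) (madj g)) = psi' (eps * u * ct g * c)"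
  unfolding PsiX_conj[OF g] conj_X[OF g]
  by (simp add: upp_def m_defs q_defs algebra_simps)

lemma Psi_dg:
  assumes g: "g \<in> Ggrp eps"
  shows "\<Psi> (mmul eps (mmul eps g (dg l)) (madj g)) = psi' (eps * u * cx g * (l - 1 / l))"
  unfolding PsiX_conj[OF g] conj_X[OF g]
  by (simp add: dg_def m_defs q_defs algebra_simps)

lemma Psi_elementary:
  "\<Psi> (low c) = psi' (eps * u * c)" "\<Psi> (upp c) = psi' (eps * u * w * c)" "\<Psi> (dg l) = 1"
  using Psi_low[OF Ggrp_mid, of c] Psi_upp[OF Ggrp_mid, of c] Psi_dg[OF Ggrp_mid, of l] by simp_all

lemma low_Kfilt: "vge nu (int n) c \<Longrightarrow> low c \<in> Kfilt nu eps n"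
  by (simp add: Kfilt_iff low_Ggrp) (simp add: low_def lat_def in_pE_def m_defs q_defs)

lemma upp_Kfilt: "vge nu (int n) c \<Longrightarrow> upp c \<in> Kfilt nu eps n"
  by (simp add: Kfilt_iff upp_Ggrp) (simp add: upp_def lat_def in_pE_def m_defs q_defs)

lemma dg_Jgrp:
  assumes c: "vge nu a c"
  shows "dg (1 + c) \<in> Jgrp nu eps d" "unit (1 + c)"
proof -
  have "unit 1" by (simp add: unit_def)
  then show un: "unit (1 + c)" by (rule unit_congruent) (use vge_mono[OF c ab(1)] in simp)
  have "1 / (1 + c) - 1 = - c / (1 + c)" using unit_nonzero[OF un] by (simp add: field_simps)
  then have "vge nu a (1 / (1 + c) - 1)" using c vge_unit_divide[OF un] by simp
  then show "dg (1 + c) \<in> Jgrp nu eps d"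
    using c unit_nonzero[OF un]
    by (simp add: Jgrp_iff dg_Ggrp) (simp add: dg_def lat_def in_pE_def m_defs q_defs)
qed

text \<open>Testing on \<open>low c\<close> and \<open>upp c\<close> with \<open>c\<close> in
  \<open>p^b\<close> puts \<open>y - 1\<close> and \<open>t - w\<close> in \<open>p^a\<close>,
  because \<open>d + 1 - b = a\<close>.\<close>

lemma intertwine_Kfilt:
  assumes g: "g \<in> Kgrp nu eps"
    and eq: "\<And>n. n \<in> Kfilt nu eps ((d + 2) div 2) \<Longrightarrow> \<Psi> (mmul eps (mmul eps g n) (madj g)) = \<Psi> n"
  shows "vge nu a (cy g - 1)" "lat 0 0 1 0 g"
proof -
  note G = Kgrp_Ggrp[OF g]
  have a: "int d + 1 - b = a" using ab by simp
  have "psi' (eps * u * (cy g - 1) * c) = 1" if "vge nu b c" for c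
    using psi_diff_eq_1 eq[OF low_Kfilt[OF that]]
    by (simp add: Psi_low[OF G] Psi_elementary algebra_simps)
  then show "vge nu a (cy g - 1)" using psi_detect_scaled[of b "cy g - 1"] a by simp
  have "psi' (eps * u * (ct g - w) * c) = 1" if "vge nu b c" for c
    using psi_diff_eq_1 eq[OF upp_Kfilt[OF that]]
    by (simp add: Psi_upp[OF G] Psi_elementary algebra_simps)
  then have "vge nu a (ct g - w)" using psi_detect_scaled[of b "ct g - w"] a by simp
  from vge_add[OF vge_mono[OF this ab(1)] w] have "vge nu 1 (ct g)" by simp
  then show "lat 0 0 1 0 g" by (rule ct_maximal_ideal[OF g])
qed

text \<open>The larger group \<open>J_d\<close> contains \<open>dg (1 + c)\<close> for
  \<open>c\<close> in \<open>p^a\<close>, which sharpens the bound on \<open>x\<close> to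
  \<open>d + 1 - a = b\<close>.\<close>

lemma intertwine_J:
  assumes g: "g \<in> Kgrp nu eps" "vge nu a (cy g - 1)" "lat 0 0 1 0 g"
    and eq: "\<And>j. j \<in> Jgrp nu eps d \<Longrightarrow> \<Psi> (mmul eps (mmul eps g j) (madj g)) = \<Psi> j"
  shows "g \<in> H"
proof -
  note G = Kgrp_Ggrp[OF g(1)]
  have "in_pE nu 1 (m21 g)" "in_pE nu 0 (m11 g)" using g(3) by (simp_all add: lat_def)
  then have "vge nu 1 (ct g)"
    unfolding ct_eq
    by (intro vge_add vge_mult[OF w qnorm_vge])
      (auto simp: qnorm_def in_pE_def intro!: vge_diff vge_mult[of 1 _ 1] vge_mult[OF eps_vge])
  then have "vge nu 1 (cy g * ct g)"
    using vge_mult[OF c_vge(2)[OF g(1)]] by simp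
  then have "vge nu 1 (eps * (cx g * cx g))"
    using w vge_diff[of 1 w "cy g * ct g"] orb_det[OF G] by (simp add: mult.assoc)
  then have x1: "vge nu 1 (cx g)"
    using vge_unit_left[OF eps_unit] vge_ideal_prime c_vge(1)[OF g(1)] by metis
  have "psi' (eps * u * (2 * cx g) * c) = 1" if c: "vge nu a c" for c
  proof -
    have un: "unit (1 + c)" using dg_Jgrp[OF c] by simp
    \<comment> \<open>Linearises the argument of \<open>Psi_dg\<close>. The quadratic error is
      invisible to \<open>psi'\<close>, since \<open>x\<close> is already in \<open>p\<close> and
      \<open>2 * a \<ge> d\<close>.\<close>
    have "1 + c - 1 / (1 + c) + c * c / (1 + c) = 2 * c"
      using unit_nonzero[OF un] by (simp add: divide_simps) (simp add: algebra_simps)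
    then have "eps * u * (2 * cx g) * c =
        eps * u * cx g * (1 + c - 1 / (1 + c)) + eps * u * cx g * (c * c / (1 + c))"
      by (metis (no_types, lifting) distrib_left mult.assoc mult.commute)
    moreover have "psi' (eps * u * cx g * (1 + c - 1 / (1 + c))) = 1"
      using eq[OF dg_Jgrp(1)[OF c]] by (simp add: Psi_dg[OF G] Psi_elementary)
    moreover have "psi' (eps * u * cx g * (c * c / (1 + c))) = 1"
    proof (rule psi_triv)
      have "vge nu (1 - int d) (eps * u * cx g)"
        using x1 vge_cancel_left[OF eps_u(1), of "1 - int d" "cx g"] by (simp add: eps_u(2))
      moreover have "vge nu (a + a) (c * c / (1 + c))"
        unfolding vge_unit_divide[OF un] by (rule vge_mult[OF c c]) simp
      ultimately show "vge nu 1 (eps * u * cx g * (c * c / (1 + c)))"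
        by (rule vge_mult) (use ab in auto)
    qed
    ultimately show ?thesis by (simp add: psi_add)
  qed
  then have "vge nu (int d + 1 - a) (cx g)"
    using psi_detect_scaled[of a "2 * cx g"] by (simp add: vge_unit_left[OF unit_2])
  then have "vge nu b (cx g)" by (rule vge_mono) (use ab in auto)
  then show ?thesis using g by (simp add: H_def)
qed

lemma centralizer_iff: "mmul eps k X = mmul eps X k \<longleftrightarrow> mmul eps k Xw = mmul eps Xw k"
proof
  assume "mmul eps k X = mmul eps X k"
  then have "msub (mmul eps k X) (mmul eps X k) = mzero" by simp
  moreover have "msub (mmul eps k X) (mmul eps X k) =
      msmul eps (QE 0 u) (msub (mmul eps k Xw) (mmul eps Xw k))"
    unfolding X_eq by (simp add: m_defs q_defs algebra_simps)
  ultimately have "msmul eps (QE 0 (1 / (eps * u)))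
      (msmul eps (QE 0 u) (msub (mmul eps k Xw) (mmul eps Xw k))) = mzero"
    by simp
  \<comment> \<open>The scalar \<open>QE 0 u\<close> multiplying \<open>Xw\<close> is invertible, so
    it can be cancelled from the commutator.\<close>
  moreover have "qmul eps (QE 0 (1 / (eps * u))) (QE 0 u) = qone"
    using eps_u(1) by (simp add: q_defs)
  ultimately show "mmul eps k Xw = mmul eps Xw k"
    by (simp add: msmul_msmul msub_eq_mzero)
next
  assume "mmul eps k Xw = mmul eps Xw k"
  then show "mmul eps k X = mmul eps X k"
    unfolding X_eq by (simp add: mmul_madd_left mmul_madd_right msmul_mmul)
qed

lemma setprod_eq_H: "setprod eps (Tcent nu eps X) (Jgrp nu eps d) = H"
proof
  show "setprod eps (Tcent nu eps X) (Jgrp nu eps d) \<subseteq> H"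
    unfolding setprod_def Tcent_def centralizer_iff
    using H_mmul centralizer_subset_H J_subset_H by blast
  show "H \<subseteq> setprod eps (Tcent nu eps X) (Jgrp nu eps d)"
    unfolding setprod_def Tcent_def centralizer_iff using H_factor by blast
qed

lemma Psi_trivial:
  assumes k: "k \<in> Kfilt nu eps (Suc d)"
  shows "\<Psi> k = 1"
  unfolding PsiX_def
proof (rule psi_triv)
  have "vge nu (- int d) v"
    unfolding v by (rule vge_mult[of "- int d" _ 1]) (use u w in \<open>auto simp: vge_def[of nu _ u]\<close>)
  then have "lat (- int d) (- int d) (- int d) (- int d) X"
    using z u by (simp add: X lat_def in_pE_def) (simp add: vge_def)
  then have "lat 1 1 1 1 (mmul eps X (msub k mid))"
    by (rule lat_mmul[OF _ conjunct2[OF k[unfolded Kfilt_iff]]]) auto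
  then show "vge nu 1 (re (mtrace (mmul eps X (msub k mid))))"
    by (auto simp: lat_def in_pE_def mtrace_def qadd_def intro: vge_add)
qed

lemma Kfilt_antimono: "m \<le> n \<Longrightarrow> k \<in> Kfilt nu eps n \<Longrightarrow> k \<in> Kfilt nu eps m"
  by (auto simp: Kfilt_iff elim: lat_mono)

section \<open>Irreducibility, depth and degree of the induced representation\<close>

context
  fixes chi :: "'a m2 \<Rightarrow> complex"
  assumes chi: "is_character eps H chi"
    and chi_J: "\<And>k. k \<in> Jgrp nu eps d \<Longrightarrow> chi k = \<Psi> k"
begin

interpretation induced_representation eps "Kgrp nu eps" H chi madj cls
proof
  show "cls g' = cls g \<longleftrightarrow> mmul eps g' (madj g) \<in> H"
    if "g \<in> Kgrp nu eps" "g' \<in> Kgrp nu eps" for g g'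
    using cls_eq_iff that .
  show "is_character eps H chi" by (rule chi)
qed (simp_all add: Kgrp_Ggrp H_subset_Kgrp H_mid H_mmul H_madj card_cls)

text \<open>Writing \<open>k n\<close> as \<open>(k n madj k) k\<close> turns right translation by
  \<open>n\<close> into multiplication by a nonzero scalar at \<open>k\<close>; in particular zeros
  of \<open>f\<close> persist.\<close>

lemma V_conj:
  assumes f: "f \<in> V" and k: "k \<in> Kgrp nu eps"
    and n: "mmul eps (mmul eps k n) (madj k) \<in> Jgrp nu eps d"
  shows "f (mmul eps k n) = \<Psi> (mmul eps (mmul eps k n) (madj k)) * f k"
  using V_mmul[OF f J_subset_H[OF n] k] chi_J[OF n] by (simp add: mmul_assoc Kgrp_Ggrp k)

lemma V_J:
  assumes f: "f \<in> V" and j: "j \<in> Jgrp nu eps d"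
  shows "f j = \<Psi> j * f mid"
  using V_conj[OF f Kgrp_mid, of j] j by simp

lemma induced_irreducible: "irreducible_rep eps (Kgrp nu eps) V"
proof (rule irreducible)
  fix W f0 assume W: "cs.subspace W" "W \<subseteq> V" "\<forall>k\<in>Kgrp nu eps. \<forall>f\<in>W. ract eps k f \<in> W"
    and f0: "f0 \<in> W" "f0 mid \<noteq> 0"
  obtain f where f: "f \<in> W" "f mid \<noteq> 0"
    and min: "\<And>n k. n \<in> Kgrp nu eps \<Longrightarrow>
       (\<And>g. g \<in> Kgrp nu eps \<Longrightarrow> f g = 0 \<Longrightarrow> f (mmul eps g n) = 0) \<Longrightarrow>
       k \<in> Kgrp nu eps \<Longrightarrow> f k \<noteq> 0 \<Longrightarrow> f (mmul eps k n) * f mid = f n * f k"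
    using ex_minimal_support[OF W f0] by metis
  have fV: "f \<in> V" using f W by blast
  \<comment> \<open>The minimality identity becomes this equality of characters after cancelling
    \<open>f k\<close> and \<open>f mid\<close>.\<close>
  have step: "\<Psi> (mmul eps (mmul eps k n) (madj k)) = \<Psi> n"
    if n: "n \<in> Jgrp nu eps d" and k: "k \<in> Kgrp nu eps" "f k \<noteq> 0"
      and nk: "mmul eps (mmul eps k n) (madj k) \<in> Jgrp nu eps d"
      and zero: "\<And>g. g \<in> Kgrp nu eps \<Longrightarrow> f g = 0 \<Longrightarrow> f (mmul eps g n) = 0" for n k
    using min[OF J_near_mid(3)[OF n] zero k] V_conj[OF fV k(1) nk] V_J[OF fV n] k(2) f(2) by simp
  have Kb: "vge nu a (cy k - 1) \<and> lat 0 0 1 0 k" if k: "k \<in> Kgrp nu eps" "f k \<noteq> 0" for k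
  proof -
    let ?N = "Kfilt nu eps ((d + 2) div 2)"
    \<comment> \<open>\<open>K_b\<close> is normal in \<open>K\<close> and contained in
      \<open>J_d\<close>, so translation by it never enlarges the support.\<close>
    have NJ: "mmul eps (mmul eps g n) (madj g) \<in> Jgrp nu eps d"
      if "n \<in> ?N" "g \<in> Kgrp nu eps" for n g
      using Kfilt_conj[OF that] by (rule Kfilt_subset_J) simp
    have "\<Psi> (mmul eps (mmul eps k n) (madj k)) = \<Psi> n" if n: "n \<in> ?N" for n
    proof (rule step[OF _ k NJ[OF n k(1)]])
      show "n \<in> Jgrp nu eps d" using n by (rule Kfilt_subset_J) simp
      show "f (mmul eps g n) = 0" if "g \<in> Kgrp nu eps" "f g = 0" for g
        using V_conj[OF fV that(1) NJ[OF n that(1)]] that(2) by simp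
    qed
    then show ?thesis using intertwine_Kfilt[OF k(1)] by blast
  qed
  have "k \<in> H" if k: "k \<in> Kgrp nu eps" "f k \<noteq> 0" for k
  proof (rule intertwine_J[OF k(1)])
    show "vge nu a (cy k - 1)" "lat 0 0 1 0 k" using Kb[OF k] by auto
    fix j assume j: "j \<in> Jgrp nu eps d"
    show "\<Psi> (mmul eps (mmul eps k j) (madj k)) = \<Psi> j"
    proof (rule step[OF j k J_conj[OF k(1) _ j]])
      show "lat 0 0 1 0 k" using Kb[OF k] by auto
      fix g assume g: "g \<in> Kgrp nu eps" "f g = 0"
      show "f (mmul eps g j) = 0"
      proof (rule ccontr)
        \<comment> \<open>\<open>J_d\<close> need not be normalised by an arbitrary zero
          \<open>g\<close>. But if \<open>g j\<close> were in the support, \<open>Kb\<close> would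
          make \<open>g j\<close>, hence \<open>g\<close>, upper triangular modulo \<open>p\<close>;
          then \<open>g\<close> normalises \<open>J_d\<close> and \<open>f (g j)\<close> vanishes
          with \<open>f g\<close>.\<close>
        assume ne: "f (mmul eps g j) \<noteq> 0"
        have "lat 0 0 1 0 (mmul eps g j)"
          using Kb[OF _ ne] g(1) J_near_mid[OF j] by simp
        then have "lat 0 0 1 0 (mmul eps (mmul eps g j) (madj j))"
          by (rule lat_mmul[of _ _ _ _ _ 0 0 1 0]) (use J_near_mid[OF j] in auto)
        then have "lat 0 0 1 0 g" using J_near_mid[OF j] by (simp add: mmul_assoc)
        then show False using V_conj[OF fV g(1) J_conj[OF g(1) _ j]] g(2) ne by simp
      qed
    qed
  qed
  with f show "\<exists>f\<in>W. f mid \<noteq> 0 \<and> (\<forall>k\<in>Kgrp nu eps. f k \<noteq> 0 \<longrightarrow> k \<in> H)" by blast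
qed

text \<open>\<open>K_(d+1)\<close> is normal in \<open>K\<close> and \<open>PsiX\<close> is trivial
  on it, whereas \<open>K_d\<close> contains an element \<open>low c\<close> with nontrivial value,
  which moves \<open>delta mid\<close>.\<close>

lemma acts_trivially_iff: "acts_trivially eps (Kfilt nu eps n) V \<longleftrightarrow> d < n"
proof
  assume "d < n"
  show "acts_trivially eps (Kfilt nu eps n) V"
    unfolding acts_trivially_def
  proof (intro ballI ext)
    fix k f x assume "k \<in> Kfilt nu eps n" and f: "f \<in> V"
    then have k: "k \<in> Kfilt nu eps (Suc d)" using \<open>d < n\<close> Kfilt_antimono[of "Suc d" n k] by simp
    show "ract eps k f x = f x"
    proof (cases "x \<in> Kgrp nu eps")
      case True
      have *: "mmul eps (mmul eps x k) (madj x) \<in> Kfilt nu eps (Suc d)"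
        by (rule Kfilt_conj[OF k True])
      then have "mmul eps (mmul eps x k) (madj x) \<in> Jgrp nu eps d"
        by (rule Kfilt_subset_J) auto
      then show ?thesis using V_conj[OF f True] Psi_trivial[OF *] by (simp add: ract_def)
    next
      case False
      then show ?thesis using Kfilt_subset_Kgrp[OF k] by (simp add: ract_def V_outside[OF f] K_mmul_iff)
    qed
  qed
next
  assume triv: "acts_trivially eps (Kfilt nu eps n) V"
  show "d < n"
  proof (rule ccontr)
    assume "\<not> d < n"
    obtain x where x: "vge nu 0 x" "psi' x \<noteq> 1" using psi_nontriv by blast
    \<comment> \<open>Solves \<open>eps * u * c = x\<close>, so that \<open>PsiX\<close> takes the
      value \<open>psi' x\<close> at \<open>low c\<close>; the valuation of \<open>u\<close> gives
      \<open>c\<close> in \<open>p^d\<close>.\<close>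
    define c where "c = x / (eps * u)"
    have c: "vge nu (int d) c" using x(1) vge_divide[OF eps_u(1)] by (simp add: c_def eps_u(2))
    have lowd: "low c \<in> Kfilt nu eps d" by (rule low_Kfilt[OF c])
    then have J: "low c \<in> Jgrp nu eps d" by (rule Kfilt_subset_J) (use d in auto)
    have "low c \<in> Kfilt nu eps n" using lowd \<open>\<not> d < n\<close> Kfilt_antimono[of n d] by simp
    then have "ract eps (low c) (delta mid) mid = delta mid mid"
      using triv delta_in_V[OF Kgrp_mid] unfolding acts_trivially_def by metis
    then have "delta mid (low c) = delta mid mid" by (simp add: ract_def)
    then have "\<Psi> (low c) = 1"
      using V_J[OF delta_in_V[OF Kgrp_mid] J] by (simp add: delta_mid_nonzero)
    then show False using x(2) eps_u(1) by (simp add: Psi_elementary c_def)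
  qed
qed

lemma induced_depth: "rep_depth nu eps V = real d"
proof -
  \<comment> \<open>\<open>d < floor r + 1\<close> holds exactly when \<open>r \<ge> d\<close>, so
    the infimum is attained at \<open>d\<close>.\<close>
  have "{r::real. 0 \<le> r \<and> acts_trivially eps (Kfilt nu eps (nat (\<lfloor>r\<rfloor> + 1))) V} = {real d..}"
  proof (intro equalityI subsetI)
    fix r assume "r \<in> {r::real. 0 \<le> r \<and> acts_trivially eps (Kfilt nu eps (nat (\<lfloor>r\<rfloor> + 1))) V}"
    then have "d < nat (\<lfloor>r\<rfloor> + 1)" "0 \<le> r" by (auto simp: acts_trivially_iff)
    then have "int d \<le> \<lfloor>r\<rfloor>" by linarith
    then show "r \<in> {real d..}" by (simp add: le_floor_iff)
  next
    fix r assume "r \<in> {real d..}"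
    then have "real d \<le> r" by simp
    then have "int d \<le> \<lfloor>r\<rfloor>" "0 \<le> r" by (simp_all add: le_floor_iff)
    then show "r \<in> {r::real. 0 \<le> r \<and> acts_trivially eps (Kfilt nu eps (nat (\<lfloor>r\<rfloor> + 1))) V}"
      by (simp add: acts_trivially_iff)
  qed
  then show ?thesis by (simp add: rep_depth_def)
qed

lemma induced_representation_properties:
  "irreducible_rep eps (Kgrp nu eps) (ind_space eps (Kgrp nu eps) H chi)"
  "rep_depth nu eps (ind_space eps (Kgrp nu eps) H chi) = real d"
  "rep_degree (ind_space eps (Kgrp nu eps) H chi) = q ^ (d - 1) * (q\<^sup>2 - 1)"
  using induced_irreducible induced_depth degree card_cls by (simp_all add: V_def)

end

end

theorem theorem5p6:
  fixes nu :: "'a::field \<Rightarrow> int" and p q d :: nat and eps z u v :: 'a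
    and psi' :: "'a \<Rightarrow> complex" and zeta chi :: "'a m2 \<Rightarrow> complex"
  assumes F: "nonarch_local_field nu p q"
    and p2: "p \<noteq> 2"
    and eps: "eps \<noteq> 0" "nu eps = 0" "\<not> (\<exists>y. y * y = eps)"
    and psi_add: "\<forall>x y. psi' (x + y) = psi' x * psi' y"
    and psi_triv: "\<forall>x. vge nu 1 x \<longrightarrow> psi' x = 1"
    and psi_nontriv: "\<exists>x. vge nu 0 x \<and> psi' x \<noteq> 1"
    and d: "d > 0"
    and z: "vge nu (- int d) z"
    and u: "u \<noteq> 0" "nu u = - int d"
    and v: "v = 0 \<or> nu v > nu u"
    and X: "X = M2 (QE 0 z) (QE 0 u) (QE 0 v) (QE 0 z)"
    and zeta: "is_character eps (Tcent nu eps X) zeta"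
    and zeta_J: "\<forall>k \<in> Tcent nu eps X \<inter> Jgrp nu eps d. zeta k = PsiX eps psi' X k"
    and chi: "is_character eps (setprod eps (Tcent nu eps X) (Jgrp nu eps d)) chi"
    and chi_T: "\<forall>k \<in> Tcent nu eps X. chi k = zeta k"
    and chi_J: "\<forall>k \<in> Jgrp nu eps d. chi k = PsiX eps psi' X k"
  shows "irreducible_rep eps (Kgrp nu eps)
           (ind_space eps (Kgrp nu eps) (setprod eps (Tcent nu eps X) (Jgrp nu eps d)) chi)
       \<and> rep_depth nu eps
           (ind_space eps (Kgrp nu eps) (setprod eps (Tcent nu eps X) (Jgrp nu eps d)) chi) = real d
       \<and> rep_degree
           (ind_space eps (Kgrp nu eps) (setprod eps (Tcent nu eps X) (Jgrp nu eps d)) chi)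
         = q ^ (d - 1) * (q\<^sup>2 - 1)"
proof -
  interpret odd_local_field nu p q by unfold_locales (fact F p2)+
  interpret unramified_extension nu p q eps
    by unfold_locales (use eps in \<open>simp_all add: unit_def\<close>)
  \<comment> \<open>The condition that \<open>v\<close> is 0 or has larger valuation than
    \<open>u\<close> says precisely that \<open>v / u\<close> lies in the maximal ideal.\<close>
  interpret nilpotent_orbit nu p q eps "v / u" d
    by unfold_locales (use v u d in \<open>auto simp: vge_divide vge_def[of nu _ v]\<close>)
  interpret regular_nilpotent_datum nu p q eps "v / u" d psi' z u v X
    by unfold_locales (use psi_add psi_triv psi_nontriv z u X in simp_all)
  show ?thesis
    unfolding setprod_eq_H
    using induced_representation_properties[of chi] chi[unfolded setprod_eq_H] chi_J by simp
qed

end
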